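(* Let $\{P_\vartheta:\vartheta\in\Theta\}$, $\Theta\subseteq\mathbb{R}^d$ with nonempty interior, be a family of probability measures on $(\mathcal{X},\mathcal{A})$, each absolutely continuous with respect to a common $\sigma$-finite measure $\mu$, let $\Pi$ be a prior on $\Theta$, and let $\vartheta_0\in\Theta^\circ$. Assume: (a) the family is differentiable in quadratic mean at $\vartheta_0$ with nonsingular Fisher information matrix $I_{\vartheta_0}$; (b) for every $\varepsilon>0$ there is a sequence of tests $\phi_n:\mathcal{X}^n\to[0,1]$ with $\mathbb{E}_{P^n_{\vartheta_0}}[\phi_n(\boldsymbol X)]\to0$ and $\sup_{\vartheta\in\Theta:\|\vartheta-\vartheta_0\|\ge\varepsilon}\mathbb{E}_{P^n_\vartheta}[1-\phi_n(\boldsymbol X)]\to0$ as $n\to\infty$; (c) $\Pi$ has a Lebesgue density $\pi$ that is continuous in a neighborhood of $\vartheta_0$ with $\pi(\vartheta_0)>0$. Let $\ell:\Theta\times\Theta\to[0,\infty)$ be a loss function for which there are constants $c_1,c_2>0$ and $0<c_3<2$ with $\ell(t,\vartheta)\le c_1\exp(c_2\|t\|^{c_3}+c_2\|\vartheta\|^{c_3})$ for all $t,\vartheta\in\Theta$. Assume that $\vartheta\mapsto\ell(t,\vartheta)$ is continuous at $\vartheta_0$ for every $t\in\Theta$, and that one of the following holds: (i) for any $M>0$ there is a $\delta>0$ such that $\inf\{\ell(t,\vartheta):t,\vartheta\in\Theta,\ \|t-\vartheta_0\|>M,\ \|\vartheta-\vartheta_0\|\le\delta\}>0$; (ii) the set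 $\Theta$ is convex and, for each $\vartheta\in\Theta$, the mapping $t\mapsto\ell(t,\vartheta)$ is convex. Then the Bayes estimator $\hat\theta_n$ with respect to $\ell$ is consistent, i.e. $\hat\theta_n\to\vartheta_0$ in $P^n_{\vartheta_0}$-probability as $n\to\infty$.
   Context: Bayes model: $\theta\sim\Pi$, a probability measure on $(\Theta,\mathcal{B}(\Theta))$, and conditionally on $\theta=\vartheta$, $X_1,\dots,X_n$ are i.i.d. with law $P_\vartheta$ (so implicitly $\vartheta\mapsto P_\vartheta(A)$ is measurable for $A\in\mathcal{A}$). Write $\boldsymbol X=(X_1,\dots,X_n)$, $P^{\boldsymbol X}$ for the marginal law of $\boldsymbol X$ in this model, $P_{\theta\mid\boldsymbol X}$ for the posterior (conditional law of $\theta$ given $\boldsymbol X$), $P^n_\vartheta=\bigotimes_{i=1}^nP_\vartheta$. Standing assumption: $P^n_{\vartheta_0}\ll P^{\boldsymbol X}$ for all $n$. Differentiability in quadratic mean at $\vartheta_0$: with $p_\vartheta=\mathrm{d}P_\vartheta/\mathrm{d}\mu$, there is $\ell'_{\vartheta_0}:\mathcal{X}\to\mathbb{R}^d$ with $\int_{\mathcal X}[p^{1/2}_{\vartheta_0+h}-p^{1/2}_{\vartheta_0}-\frac12\langle h,\ell'_{\vartheta_0}\rangle p^{1/2}_{\vartheta_0}]^2\,\mathrm{d}\mu=o(\|h\|^2)$ as $h\to0$. Fisher information: $I_{\vartheta_0}=\int\ell'_{\vartheta_0}(\ell'_{\vartheta_0})^\top\,\mathrm{d}P_{\vartheta_0}$.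 A loss function is a jointly measurable $\ell:\Theta\times\Theta\to[0,\infty)$ with $\ell(t,\vartheta)=0$ if and only if $t=\vartheta$. Standing assumption: $\int_\Theta\ell(t,\vartheta)\,\mathrm{d}\Pi(\vartheta)<\infty$ for every $t\in\Theta$. A Bayes estimator with respect to $\ell$ is a measurable $\hat\theta_n:\mathcal{X}^n\to\Theta$ with $\hat\theta_n(x)\in\arg\min_{t\in\Theta}\int_\Theta\ell(t,\vartheta)\,\mathrm{d}P_{\theta\mid\boldsymbol X=x}(\vartheta)$ for $P^{\boldsymbol X}$-a.e. $x$; it is assumed throughout that a Bayes estimator exists, and $\hat\theta_n$ also denotes $\hat\theta_n(\boldsymbol X)$. $\|\cdot\|$ is the Euclidean norm. *)

theory Defs
  imports "HOL-Probability.Probability" "HOL-Library.Landau_Symbols"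
begin

section \<open>The Bayes model\<close>

text \<open>
  The parameter set \<open>\<Theta>\<close> carries the trace of the Borel sets, and is not required to be
  a Borel set itself. In the following, \<open>M\<close> plays the role of the measurable space
  \<open>(\<X>, \<A>)\<close>: only its carrier and its sets matter.
\<close>

abbreviation param_space :: "(real ^ 'd) set \<Rightarrow> (real ^ 'd) measure" where
  "param_space \<Theta> \<equiv> restrict_space borel \<Theta>"

abbreviation (input) sample_space :: "'x measure \<Rightarrow> nat \<Rightarrow> (nat \<Rightarrow> 'x) measure" where
  "sample_space M n \<equiv> PiM {..<n} (\<lambda>_. M)"

abbreviation (input) iid_law :: "'x measure \<Rightarrow> nat \<Rightarrow> (nat \<Rightarrow> 'x) measure" where
  "iid_law Q n \<equiv> PiM {..<n} (\<lambda>_. Q)"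

definition joint_law ::
  "'x measure \<Rightarrow> ('t \<Rightarrow> 'x measure) \<Rightarrow> 't measure \<Rightarrow> nat \<Rightarrow> ('t \<times> (nat \<Rightarrow> 'x)) measure" where
  "joint_law M P prior n =
     prior \<bind> (\<lambda>\<theta>. iid_law (P \<theta>) n \<bind> (\<lambda>x. return (prior \<Otimes>\<^sub>M sample_space M n) (\<theta>, x)))"

definition marginal_law ::
  "'x measure \<Rightarrow> ('t \<Rightarrow> 'x measure) \<Rightarrow> 't measure \<Rightarrow> nat \<Rightarrow> (nat \<Rightarrow> 'x) measure" where
  "marginal_law M P prior n = distr (joint_law M P prior n) (sample_space M n) snd"

text \<open>
  \<open>K\<close> is a version of the posterior, i.e. a regular conditional distribution of the
  parameter given the sample.
\<close>

definition is_posterior ::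
  "'x measure \<Rightarrow> ('t \<Rightarrow> 'x measure) \<Rightarrow> 't measure \<Rightarrow> nat \<Rightarrow> ((nat \<Rightarrow> 'x) \<Rightarrow> 't measure) \<Rightarrow> bool" where
  "is_posterior M P prior n K \<longleftrightarrow>
     K \<in> sample_space M n \<rightarrow>\<^sub>M prob_algebra prior \<and>
     (\<forall>A\<in>sets prior. \<forall>B\<in>sets (sample_space M n).
        emeasure (joint_law M P prior n) (A \<times> B) =
          (\<integral>\<^sup>+x\<in>B. emeasure (K x) A \<partial>marginal_law M P prior n))"


section \<open>Differentiability in quadratic mean\<close>

definition sqrt_dens :: "'x measure \<Rightarrow> 'x measure \<Rightarrow> 'x \<Rightarrow> real" where
  "sqrt_dens \<mu> Q x = sqrt (enn2real (RN_deriv \<mu> Q x))"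

text \<open>
  Integrability is demanded explicitly because the Bochner integral of a non-integrable
  function is \<open>0\<close>. The filter \<open>at 0\<close> is adequate because the notion is only used at interior
  points of the parameter set.
\<close>

definition dqm_at ::
  "'x measure \<Rightarrow> (real ^ 'd \<Rightarrow> 'x measure) \<Rightarrow> real ^ 'd \<Rightarrow> ('x \<Rightarrow> real ^ 'd) \<Rightarrow> bool" where
  "dqm_at \<mu> P \<theta>\<^sub>0 score \<longleftrightarrow>
     score \<in> borel_measurable \<mu> \<and>
     (let r = (\<lambda>h x. (sqrt_dens \<mu> (P (\<theta>\<^sub>0 + h)) x - sqrt_dens \<mu> (P \<theta>\<^sub>0) x
                     - 1 / 2 * (h \<bullet> score x) * sqrt_dens \<mu> (P \<theta>\<^sub>0) x)\<^sup>2)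
      in (\<forall>\<^sub>F h in at 0. integrable \<mu> (r h)) \<and>
         (\<lambda>h. \<integral>x. r h x \<partial>\<mu>) \<in> o[at 0](\<lambda>h. (norm h)\<^sup>2))"

definition fisher_information :: "'x measure \<Rightarrow> ('x \<Rightarrow> real ^ 'd) \<Rightarrow> real ^ 'd ^ 'd" where
  "fisher_information Q score = (\<chi> i j. \<integral>x. score x $ i * score x $ j \<partial>Q)"


section \<open>Tests\<close>

text \<open>
  The supremum is taken in \<^typ>\<open>ennreal\<close>, so that it is \<open>0\<close> if no parameter has distance at
  least \<open>\<epsilon>\<close> from \<open>\<theta>\<^sub>0\<close>. Samples have size at least one throughout.
\<close>

definition uniformly_consistent_tests ::
  "'x measure \<Rightarrow> (real ^ 'd) set \<Rightarrow> (real ^ 'd \<Rightarrow> 'x measure) \<Rightarrow> real ^ 'd \<Rightarrow> real \<Rightarrow>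
     (nat \<Rightarrow> (nat \<Rightarrow> 'x) \<Rightarrow> real) \<Rightarrow> bool" where
  "uniformly_consistent_tests M \<Theta> P \<theta>\<^sub>0 \<epsilon> \<phi> \<longleftrightarrow>
     (\<forall>n\<ge>1. \<phi> n \<in> borel_measurable (sample_space M n) \<and>
             (\<forall>x\<in>space (sample_space M n). \<phi> n x \<in> {0..1})) \<and>
     (\<lambda>n. \<integral>x. \<phi> n x \<partial>iid_law (P \<theta>\<^sub>0) n) \<longlonglongrightarrow> 0 \<and>
     (\<lambda>n. SUP \<theta>\<in>{\<theta>\<in>\<Theta>. norm (\<theta> - \<theta>\<^sub>0) \<ge> \<epsilon>}.
            ennreal (\<integral>x. 1 - \<phi> n x \<partial>iid_law (P \<theta>) n)) \<longlonglongrightarrow> 0"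


section \<open>Loss functions and Bayes estimators\<close>

definition loss_function :: "(real ^ 'd) set \<Rightarrow> (real ^ 'd \<Rightarrow> real ^ 'd \<Rightarrow> real) \<Rightarrow> bool" where
  "loss_function \<Theta> loss \<longleftrightarrow>
     case_prod loss \<in> borel_measurable (param_space \<Theta> \<Otimes>\<^sub>M param_space \<Theta>) \<and>
     (\<forall>t\<in>\<Theta>. \<forall>\<theta>\<in>\<Theta>. loss t \<theta> \<ge> 0 \<and> (loss t \<theta> = 0 \<longleftrightarrow> t = \<theta>))"

text \<open>
  Expected losses are non-negative Lebesgue integrals, so an infinite value is never minimal
  unless all values are infinite.
\<close>

definition expected_loss ::
  "('t \<Rightarrow> 't \<Rightarrow> real) \<Rightarrow> 't measure \<Rightarrow> 't \<Rightarrow> ennreal" where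
  "expected_loss loss \<nu> t = (\<integral>\<^sup>+\<theta>. ennreal (loss t \<theta>) \<partial>\<nu>)"

text \<open>\<open>K\<close> is the posterior for sample size \<open>n\<close>, and \<open>T\<close> the estimator.\<close>

definition is_bayes_estimator ::
  "'x measure \<Rightarrow> (real ^ 'd) set \<Rightarrow> (real ^ 'd \<Rightarrow> 'x measure) \<Rightarrow> (real ^ 'd) measure \<Rightarrow>
     (real ^ 'd \<Rightarrow> real ^ 'd \<Rightarrow> real) \<Rightarrow> nat \<Rightarrow> ((nat \<Rightarrow> 'x) \<Rightarrow> (real ^ 'd) measure) \<Rightarrow>
     ((nat \<Rightarrow> 'x) \<Rightarrow> real ^ 'd) \<Rightarrow> bool" where
  "is_bayes_estimator M \<Theta> P prior loss n K T \<longleftrightarrow>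
     T \<in> sample_space M n \<rightarrow>\<^sub>M param_space \<Theta> \<and>
     (AE x in marginal_law M P prior n.
        is_arg_min (expected_loss loss (K x)) (\<lambda>t. t \<in> \<Theta>) (T x))"

definition consistent_at ::
  "(nat \<Rightarrow> (nat \<Rightarrow> 'x) \<Rightarrow> real ^ 'd) \<Rightarrow> 'x measure \<Rightarrow> real ^ 'd \<Rightarrow> bool" where
  "consistent_at T Q \<theta>\<^sub>0 \<longleftrightarrow>
     (\<forall>\<epsilon>>0. (\<lambda>n. measure (iid_law Q n) {x \<in> space (iid_law Q n). norm (T n x - \<theta>\<^sub>0) > \<epsilon>})
              \<longlonglongrightarrow> 0)"

end

theory Submission
  imports Defs
begin

text \<open>
  Differentiability in quadratic mean enters only through the bound \<open>C * norm (\<theta> - \<theta>\<^sub>0)\<close> on the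
  total variation distance of \<open>P \<theta>\<close> and \<open>P \<theta>\<^sub>0\<close>, which becomes \<open>n * C * norm (\<theta> - \<theta>\<^sub>0)\<close> for
  samples of size \<open>n\<close>. Uniformly consistent tests can be sharpened to have exponentially small
  errors, so the posterior mass, and the posterior integral of any prior-integrable function,
  away from \<open>\<theta>\<^sub>0\<close> are exponentially small under the marginal law of the sample on the acceptance
  regions. As the prior puts polynomial mass on the ball of radius \<open>1/n\<^sup>2\<close>, on which the law of
  the sample is almost that under \<open>\<theta>\<^sub>0\<close>, this carries over to the true law.

  Applied to \<open>loss \<theta>\<^sub>0 + 1\<close>, this shows that the expected posterior loss of \<open>\<theta>\<^sub>0\<close> tends to \<open>0\<close>,
  whereas that of parameters far from \<open>\<theta>\<^sub>0\<close> is bounded away from \<open>0\<close> by separation. The convex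
  case reduces to the separated one, since pointwise convergence of convex functions is locally
  uniform.
\<close>

section \<open>Joint law, marginal law and posterior\<close>

text \<open>Boxes form an intersection-stable generator of the product sigma-algebra, and the
  measure of a box is a finite product of functions that are measurable in
  \<open>\<theta>\<close>.\<close>

lemma measurable_iid_law:
  assumes P: "P \<in> N \<rightarrow>\<^sub>M prob_algebra M" and I: "finite I"
  shows "(\<lambda>\<theta>. PiM I (\<lambda>_. P \<theta>)) \<in> N \<rightarrow>\<^sub>M prob_algebra (PiM I (\<lambda>_. M))"
proof (rule measurable_prob_algebra_generated)
  have *: "sets (P \<theta>) = sets M" "prob_space (P \<theta>)" if "\<theta> \<in> space N" for \<theta>
    using measurable_space[OF P that] by (auto simp: space_prob_algebra)
  show "sets (PiM I (\<lambda>_. M)) = sigma_sets (\<Pi>\<^sub>E i\<in>I. space M) (prod_algebra I (\<lambda>_. M))"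
    by (simp add: sets_PiM)
  show "Int_stable (prod_algebra I (\<lambda>_. M))"
    by (rule Int_stable_prod_algebra)
  show "prod_algebra I (\<lambda>_. M) \<subseteq> Pow (\<Pi>\<^sub>E i\<in>I. space M)"
    by (rule prod_algebra_sets_into_space)
  show "prob_space (PiM I (\<lambda>_. P \<theta>))" if "\<theta> \<in> space N" for \<theta>
    using * that by (intro prob_space_PiM) auto
  show "sets (PiM I (\<lambda>_. P \<theta>)) = sets (PiM I (\<lambda>_. M))" if "\<theta> \<in> space N" for \<theta>
    using * that by (intro sets_PiM_cong) auto
  fix A assume "A \<in> prod_algebra I (\<lambda>_. M)"
  then obtain E where E: "A = (\<Pi>\<^sub>E i\<in>I. E i)" "\<And>i. i \<in> I \<Longrightarrow> E i \<in> sets M"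
    unfolding prod_algebra_eq_finite[OF I] by auto
  have "emeasure (PiM I (\<lambda>_. P \<theta>)) A = (\<Prod>i\<in>I. emeasure (P \<theta>) (E i))" if "\<theta> \<in> space N" for \<theta>
  proof -
    interpret product_prob_space "\<lambda>_. P \<theta>" I
      using * that by (auto intro!: product_prob_spaceI)
    show ?thesis using E(2) *[OF that] I unfolding E(1) by (intro emeasure_PiM) auto
  qed
  moreover have "(\<lambda>\<theta>. \<Prod>i\<in>I. emeasure (P \<theta>) (E i)) \<in> borel_measurable N"
    using E(2) measurable_prob_algebraD[OF P]
    by (intro borel_measurable_prod_ennreal measurable_emeasure_kernel) auto
  ultimately show "(\<lambda>\<theta>. emeasure (PiM I (\<lambda>_. P \<theta>)) A) \<in> borel_measurable N"
    by (simp cong: measurable_cong)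
qed

text \<open>The inner kernel only pairs \<open>\<theta>\<close> with a draw from
  \<open>iid_law (P \<theta>) n\<close>, and the section of the rectangle at \<open>\<theta>\<close>
  is \<open>B\<close> or empty according to whether \<open>\<theta>\<close> lies in
  \<open>A\<close>.\<close>

lemma emeasure_joint_law:
  assumes P: "P \<in> prior \<rightarrow>\<^sub>M prob_algebra M" and prior: "prob_space prior"
    and A: "A \<in> sets prior" and B: "B \<in> sets (sample_space M n)"
  shows "emeasure (joint_law M P prior n) (A \<times> B) =
           (\<integral>\<^sup>+\<theta>\<in>A. emeasure (iid_law (P \<theta>) n) B \<partial>prior)"
proof -
  let ?S = "sample_space M n"
  interpret prior: prob_space prior by fact
  have K: "(\<lambda>\<theta>. iid_law (P \<theta>) n) \<in> prior \<rightarrow>\<^sub>M prob_algebra ?S"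
    using P by (rule measurable_iid_law) simp
  have "(\<lambda>\<theta>. iid_law (P \<theta>) n \<bind> (\<lambda>x. return (prior \<Otimes>\<^sub>M ?S) (\<theta>, x)))
      \<in> prior \<rightarrow>\<^sub>M subprob_algebra (prior \<Otimes>\<^sub>M ?S)"
    using measurable_prob_algebraD[OF K] by (rule measurable_bind) simp
  then have "emeasure (joint_law M P prior n) (A \<times> B) =
     (\<integral>\<^sup>+\<theta>. emeasure (iid_law (P \<theta>) n \<bind> (\<lambda>x. return (prior \<Otimes>\<^sub>M ?S) (\<theta>, x))) (A \<times> B) \<partial>prior)"
    unfolding joint_law_def using A B prior.not_empty by (intro emeasure_bind) auto
  also have "\<dots> = (\<integral>\<^sup>+\<theta>\<in>A. emeasure (iid_law (P \<theta>) n) B \<partial>prior)"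
  proof (rule nn_integral_cong)
    fix \<theta> assume \<theta>: "\<theta> \<in> space prior"
    from measurable_space[OF K this] have s: "sets (iid_law (P \<theta>) n) = sets ?S"
      and p: "prob_space (iid_law (P \<theta>) n)"
      by (auto simp: space_prob_algebra)
    have m: "(\<lambda>x. (\<theta>, x)) \<in> iid_law (P \<theta>) n \<rightarrow>\<^sub>M prior \<Otimes>\<^sub>M ?S"
      unfolding measurable_cong_sets[OF s refl] using \<theta> by (rule measurable_Pair1')
    then have "iid_law (P \<theta>) n \<bind> (\<lambda>x. return (prior \<Otimes>\<^sub>M ?S) (\<theta>, x)) =
        distr (iid_law (P \<theta>) n) (prior \<Otimes>\<^sub>M ?S) (\<lambda>x. (\<theta>, x))"
      using prob_space.not_empty[OF p] by (intro bind_return_distr')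
    moreover note m
    moreover have "(\<lambda>x. (\<theta>, x)) -` (A \<times> B) \<inter> space (iid_law (P \<theta>) n) = (if \<theta> \<in> A then B else {})"
      using sets.sets_into_space[OF B] sets_eq_imp_space_eq[OF s] by auto
    ultimately show "emeasure (iid_law (P \<theta>) n \<bind> (\<lambda>x. return (prior \<Otimes>\<^sub>M ?S) (\<theta>, x))) (A \<times> B)
        = emeasure (iid_law (P \<theta>) n) B * indicator A \<theta>"
      using A B by (simp add: emeasure_distr)
  qed
  finally show ?thesis .
qed

lemma sets_joint_law:
  assumes "P \<in> prior \<rightarrow>\<^sub>M prob_algebra M" and "prob_space prior"
  shows "sets (joint_law M P prior n) = sets (prior \<Otimes>\<^sub>M sample_space M n)"
proof -
  have "sets (iid_law (P \<theta>) n \<bind> (\<lambda>x. return (prior \<Otimes>\<^sub>M sample_space M n) (\<theta>, x)))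
     = sets (prior \<Otimes>\<^sub>M sample_space M n)" if "\<theta> \<in> space prior" for \<theta>
  proof (rule sets_bind[where N="prior \<Otimes>\<^sub>M sample_space M n"])
    have "prob_space (P \<theta>)" using measurable_space[OF assms(1) that] by (auto simp: space_prob_algebra)
    then show "space (iid_law (P \<theta>) n) \<noteq> {}"
      by (intro prob_space.not_empty prob_space_PiM)
  qed simp
  then show ?thesis
    unfolding joint_law_def using prob_space.not_empty[OF assms(2)]
    by (rule sets_bind[where N="prior \<Otimes>\<^sub>M sample_space M n"])
qed

lemma emeasure_marginal_law:
  assumes P: "P \<in> prior \<rightarrow>\<^sub>M prob_algebra M" and prior: "prob_space prior"
    and B: "B \<in> sets (sample_space M n)"
  shows "emeasure (marginal_law M P prior n) B =
           (\<integral>\<^sup>+\<theta>. emeasure (iid_law (P \<theta>) n) B \<partial>prior)"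
proof -
  have s: "sets (joint_law M P prior n) = sets (prior \<Otimes>\<^sub>M sample_space M n)"
    using P prior by (rule sets_joint_law)
  then have "snd -` B \<inter> space (joint_law M P prior n) = space prior \<times> B"
    using sets_eq_imp_space_eq[OF s] sets.sets_into_space[OF B] by (auto simp: space_pair_measure)
  moreover have "snd \<in> joint_law M P prior n \<rightarrow>\<^sub>M sample_space M n"
    unfolding measurable_cong_sets[OF s refl] by simp
  ultimately have "emeasure (marginal_law M P prior n) B = emeasure (joint_law M P prior n) (space prior \<times> B)"
    unfolding marginal_law_def using B by (simp add: emeasure_distr)
  also have "\<dots> = (\<integral>\<^sup>+\<theta>. emeasure (iid_law (P \<theta>) n) B \<partial>prior)"
    by (simp add: emeasure_joint_law[OF P prior _ B] cong: nn_integral_cong)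
  finally show ?thesis .
qed

text \<open>Bayes' formula in integrated form. The defining identity of the posterior on rectangles
  says that two measures on the parameter space agree: \<open>K\<close> mixed over the marginal law
  restricted to \<open>B\<close>, and the prior weighted by the likelihood of \<open>B\<close>.
  Equal measures integrate every \<open>g\<close> alike. This turns posterior integrals into prior
  integrals of error probabilities.\<close>

lemma posterior_nn_integral:
  assumes P: "P \<in> prior \<rightarrow>\<^sub>M prob_algebra M" and prior: "prob_space prior"
    and K: "is_posterior M P prior n K" and B: "B \<in> sets (sample_space M n)"
    and g: "g \<in> borel_measurable prior"
  shows "(\<integral>\<^sup>+x\<in>B. (\<integral>\<^sup>+\<theta>. g \<theta> \<partial>K x) \<partial>marginal_law M P prior n) =
           (\<integral>\<^sup>+\<theta>. g \<theta> * emeasure (iid_law (P \<theta>) n) B \<partial>prior)"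
proof -
  let ?m = "marginal_law M P prior n"
  interpret prior: prob_space prior by fact
  have sm: "sets ?m = sets (sample_space M n)" by (simp add: marginal_law_def)
  have Km: "K \<in> ?m \<rightarrow>\<^sub>M subprob_algebra prior"
    using K measurable_cong_sets[OF sm refl] by (auto simp: is_posterior_def dest: measurable_prob_algebraD)
  have e: "(\<lambda>\<theta>. emeasure (iid_law (P \<theta>) n) B) \<in> borel_measurable prior"
    using measurable_prob_algebraD[OF measurable_iid_law[OF P]] B by (rule measurable_emeasure_kernel) simp
  have J: "emeasure (joint_law M P prior n) (A \<times> B) = (\<integral>\<^sup>+x\<in>B. emeasure (K x) A \<partial>?m)" if "A \<in> sets prior" for A
    using K B that by (auto simp: is_posterior_def)
  have d: "density ?m (indicator B) \<bind> K = density prior (\<lambda>\<theta>. emeasure (iid_law (P \<theta>) n) B)"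
  proof -
    \<comment> \<open>A bind over an empty space is degenerate, so the sample space must first be
      seen to be nonempty.\<close>
    obtain \<theta> where "\<theta> \<in> space prior" using prior.not_empty by auto
    with measurable_space[OF P] have "prob_space (P \<theta>)" "sets (P \<theta>) = sets M"
      by (auto simp: space_prob_algebra)
    then have "space M \<noteq> {}"
      using prob_space.not_empty sets_eq_imp_space_eq by metis
    then have ne: "space (density ?m (indicator B)) \<noteq> {}"
      by (simp add: sets_eq_imp_space_eq[OF sm])
    have Kd: "K \<in> density ?m (indicator B) \<rightarrow>\<^sub>M subprob_algebra prior"
      using Km measurable_cong_sets[OF sets_density refl] by blast
    have sK: "sets (density ?m (indicator B) \<bind> K) = sets prior"
      using sets_kernel[OF Kd] ne by (intro sets_bind) auto
    show ?thesis
    proof (rule measure_eqI)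
      fix A assume "A \<in> sets (density ?m (indicator B) \<bind> K)"
      with sK have A: "A \<in> sets prior" by simp
      have "emeasure (density ?m (indicator B) \<bind> K) A = (\<integral>\<^sup>+x. emeasure (K x) A \<partial>density ?m (indicator B))"
        using ne Kd A by (rule emeasure_bind)
      also have "\<dots> = (\<integral>\<^sup>+x. indicator B x * emeasure (K x) A \<partial>?m)"
        using B sm measurable_emeasure_kernel[OF Km A] by (intro nn_integral_density) auto
      also have "\<dots> = emeasure (joint_law M P prior n) (A \<times> B)"
        using J[OF A] by (simp add: mult.commute)
      also have "\<dots> = emeasure (density prior (\<lambda>\<theta>. emeasure (iid_law (P \<theta>) n) B)) A"
        using e A by (simp add: emeasure_joint_law[OF P prior A B] emeasure_density)
      finally show "emeasure (density ?m (indicator B) \<bind> K) A =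
        emeasure (density prior (\<lambda>\<theta>. emeasure (iid_law (P \<theta>) n) B)) A" .
    qed (simp add: sK)
  qed
  have "(\<integral>\<^sup>+x\<in>B. (\<integral>\<^sup>+\<theta>. g \<theta> \<partial>K x) \<partial>?m) = (\<integral>\<^sup>+x. (\<integral>\<^sup>+\<theta>. g \<theta> \<partial>K x) \<partial>density ?m (indicator B))"
    using B sm nn_integral_measurable_subprob_algebra2[of "\<lambda>_. g" ?m prior K] g Km
    by (subst nn_integral_density) (auto simp: mult.commute)
  also have "\<dots> = (\<integral>\<^sup>+\<theta>. g \<theta> \<partial>(density ?m (indicator B) \<bind> K))"
    using g Km measurable_cong_sets[OF sets_density refl]
    by (intro nn_integral_bind[symmetric]) blast+
  also have "\<dots> = (\<integral>\<^sup>+\<theta>. g \<theta> * emeasure (iid_law (P \<theta>) n) B \<partial>prior)"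
    unfolding d using e g by (simp add: nn_integral_density mult.commute)
  finally show ?thesis .
qed

section \<open>Total variation between product laws\<close>

text \<open>The coordinates are exchanged one at a time, each exchange costing \<open>c\<close>. The
  claim is made for functions bounded by 1 rather than for sets because integrating out one
  coordinate preserves this class.\<close>

lemma nn_integral_iid_law_le:
  fixes c :: ennreal
  assumes Q: "prob_space Q" "sets Q = sets M" and R: "prob_space R" "sets R = sets M"
    and le: "\<And>f. f \<in> borel_measurable M \<Longrightarrow> (\<And>x. f x \<le> 1) \<Longrightarrow> (\<integral>\<^sup>+x. f x \<partial>Q) \<le> (\<integral>\<^sup>+x. f x \<partial>R) + c"
    and f: "f \<in> borel_measurable (sample_space M n)" "\<And>x. f x \<le> 1"
  shows "(\<integral>\<^sup>+x. f x \<partial>iid_law Q n) \<le> (\<integral>\<^sup>+x. f x \<partial>iid_law R n) + of_nat n * c"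
  using f
proof (induction n arbitrary: f)
  case 0
  then show ?case by (simp add: PiM_empty)
next
  case (Suc n)
  interpret Q: product_prob_space "\<lambda>_. Q" "{..<Suc n}" using Q by (auto intro!: product_prob_spaceI)
  interpret R: product_prob_space "\<lambda>_. R" "{..<Suc n}" using R by (auto intro!: product_prob_spaceI)
  interpret Qn: prob_space "iid_law Q n" using Q by (intro prob_space_PiM)
  have sQ: "sets (PiM I (\<lambda>_. Q)) = sets (PiM I (\<lambda>_. M))" for I :: "nat set"
    using Q by (intro sets_PiM_cong) auto
  have sR: "sets (PiM I (\<lambda>_. R)) = sets (PiM I (\<lambda>_. M))" for I :: "nat set"
    using R by (intro sets_PiM_cong) auto
  have f: "f \<in> borel_measurable (PiM (insert n {..<n}) (\<lambda>_. M))"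
    using Suc.prems(1) by (simp add: lessThan_Suc)
  have upd: "(\<lambda>(x, y). f (x(n := y))) \<in> borel_measurable (sample_space M n \<Otimes>\<^sub>M M)"
    using f by (auto intro!: measurable_compose[OF measurable_add_dim] simp: split_beta')
  have updy: "(\<lambda>y. f (x(n := y))) \<in> borel_measurable M" if "x \<in> space (sample_space M n)" for x
    using measurable_Pair2[OF upd that] by simp
  have in_R: "(\<lambda>x. \<integral>\<^sup>+y. f (x(n := y)) \<partial>R) \<in> borel_measurable (sample_space M n)"
  proof -
    have "(\<lambda>(x, y). f (x(n := y))) \<in> borel_measurable (sample_space M n \<Otimes>\<^sub>M R)"
      using upd R(2) by (simp cong: measurable_cong_sets sets_pair_measure_cong)
    then show ?thesis
      using sigma_finite_measure.borel_measurable_nn_integral[of R] R(1)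
      by (simp add: prob_space_imp_sigma_finite)
  qed
  have "(\<integral>\<^sup>+x. f x \<partial>iid_law Q (Suc n)) = (\<integral>\<^sup>+x. \<integral>\<^sup>+y. f (x(n := y)) \<partial>Q \<partial>iid_law Q n)"
    unfolding lessThan_Suc using f measurable_cong_sets[OF sQ refl]
    by (intro Q.product_nn_integral_insert) auto
  \<comment> \<open>With the other coordinates fixed, the law of the last coordinate is
    exchanged.\<close>
  also have "\<dots> \<le> (\<integral>\<^sup>+x. (\<integral>\<^sup>+y. f (x(n := y)) \<partial>R) + c \<partial>iid_law Q n)"
    using Suc.prems(2) updy sets_eq_imp_space_eq[OF sQ] by (intro nn_integral_mono le) auto
  also have "\<dots> = (\<integral>\<^sup>+x. \<integral>\<^sup>+y. f (x(n := y)) \<partial>R \<partial>iid_law Q n) + c"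
    using in_R measurable_cong_sets[OF sQ refl]
    by (subst nn_integral_add) (auto simp: Qn.emeasure_space_1)
  \<comment> \<open>The inner integral under \<open>R\<close> is again bounded by 1, so the
    induction hypothesis exchanges the remaining \<open>n\<close> coordinates.\<close>
  also have "\<dots> \<le> ((\<integral>\<^sup>+x. \<integral>\<^sup>+y. f (x(n := y)) \<partial>R \<partial>iid_law R n) + of_nat n * c) + c"
  proof (intro add_right_mono Suc.IH in_R)
    fix x
    have "(\<integral>\<^sup>+y. f (x(n := y)) \<partial>R) \<le> (\<integral>\<^sup>+y. 1 \<partial>R)"
      using Suc.prems(2) by (intro nn_integral_mono)
    then show "(\<integral>\<^sup>+y. f (x(n := y)) \<partial>R) \<le> 1"
      using prob_space.emeasure_space_1[OF R(1)] by simp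
  qed
  also have "(\<integral>\<^sup>+x. \<integral>\<^sup>+y. f (x(n := y)) \<partial>R \<partial>iid_law R n) = (\<integral>\<^sup>+x. f x \<partial>iid_law R (Suc n))"
    unfolding lessThan_Suc using f measurable_cong_sets[OF sR refl]
    by (intro R.product_nn_integral_insert[symmetric]) auto
  finally show ?case by (simp add: algebra_simps)
qed

text \<open>The density has total mass 1 and is therefore finite almost everywhere, so the value 0
  that \<open>enn2real\<close> assigns to infinity matters only on a null set.\<close>

lemma nn_integral_sqrt_dens:
  assumes \<mu>: "sigma_finite_measure \<mu>" and ac: "absolutely_continuous \<mu> Q"
    and Q: "prob_space Q" "sets Q = sets \<mu>" and f: "f \<in> borel_measurable \<mu>"
  shows "(\<integral>\<^sup>+x. f x \<partial>Q) = (\<integral>\<^sup>+x. ennreal ((sqrt_dens \<mu> Q x)\<^sup>2) * f x \<partial>\<mu>)"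
proof -
  interpret sigma_finite_measure \<mu> by fact
  have d: "density \<mu> (RN_deriv \<mu> Q) = Q" using ac Q(2) by (rule density_RN_deriv)
  have "(\<integral>\<^sup>+x. RN_deriv \<mu> Q x \<partial>\<mu>) = emeasure (density \<mu> (RN_deriv \<mu> Q)) (space \<mu>)"
    by (simp add: emeasure_density cong: nn_integral_cong)
  also have "\<dots> = 1"
    unfolding d using prob_space.emeasure_space_1[OF Q(1)] sets_eq_imp_space_eq[OF Q(2)] by simp
  finally have "AE x in \<mu>. RN_deriv \<mu> Q x \<noteq> \<infinity>"
    by (intro nn_integral_PInf_AE) auto
  then have ae: "AE x in \<mu>. RN_deriv \<mu> Q x = ennreal ((sqrt_dens \<mu> Q x)\<^sup>2)"
    by eventually_elim (simp add: sqrt_dens_def less_top)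
  have "(\<integral>\<^sup>+x. f x \<partial>Q) = (\<integral>\<^sup>+x. f x \<partial>density \<mu> (RN_deriv \<mu> Q))" by (simp add: d)
  also have "\<dots> = (\<integral>\<^sup>+x. RN_deriv \<mu> Q x * f x \<partial>\<mu>)"
    using f by (intro nn_integral_density) auto
  also have "\<dots> = (\<integral>\<^sup>+x. ennreal ((sqrt_dens \<mu> Q x)\<^sup>2) * f x \<partial>\<mu>)"
    using ae by (intro nn_integral_cong_AE) auto
  finally show ?thesis .
qed

text \<open>For the root densities \<open>a\<close> and \<open>b h\<close>, the difference of the
  densities is the product of \<open>a - b h\<close>, whose L2 norm is of order
  \<open>norm h\<close> by differentiability in quadratic mean, and \<open>a + b h\<close>, whose L2
  norm is bounded. The first estimate needs a finite second moment of the score, which is extracted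
  from differentiability itself.\<close>

lemma dqm_at_imp_nn_integral_le:
  fixes \<theta>\<^sub>0 :: "real ^ 'd" and \<mu> :: "'x measure"
  assumes \<theta>\<^sub>0: "\<theta>\<^sub>0 \<in> interior \<Theta>" and \<mu>: "sigma_finite_measure \<mu>"
    and P: "\<And>\<theta>. \<theta> \<in> \<Theta> \<Longrightarrow> prob_space (P \<theta>)" "\<And>\<theta>. \<theta> \<in> \<Theta> \<Longrightarrow> sets (P \<theta>) = sets \<mu>"
    and ac: "\<And>\<theta>. \<theta> \<in> \<Theta> \<Longrightarrow> absolutely_continuous \<mu> (P \<theta>)"
    and dqm: "dqm_at \<mu> P \<theta>\<^sub>0 score"
  obtains C r :: real where "C \<ge> 0" "r > 0"
    "\<And>\<theta> f. norm (\<theta> - \<theta>\<^sub>0) < r \<Longrightarrow> f \<in> borel_measurable \<mu> \<Longrightarrow> (\<And>x. f x \<le> 1) \<Longrightarrow>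
       (\<integral>\<^sup>+x. f x \<partial>P \<theta>\<^sub>0) \<le> (\<integral>\<^sup>+x. f x \<partial>P \<theta>) + ennreal (C * norm (\<theta> - \<theta>\<^sub>0))"
proof -
  define a where "a = sqrt_dens \<mu> (P \<theta>\<^sub>0)"
  define b where "b h = sqrt_dens \<mu> (P (\<theta>\<^sub>0 + h))" for h
  define R where "R h x = (b h x - a x - 1 / 2 * (h \<bullet> score x) * a x)\<^sup>2" for h x
  have score[measurable]: "score \<in> borel_measurable \<mu>" using dqm by (simp add: dqm_at_def)
  have meas[measurable]: "a \<in> borel_measurable \<mu>" "b h \<in> borel_measurable \<mu>" for h
    by (auto simp: a_def b_def sqrt_dens_def[abs_def])
  have R0: "R h x \<ge> 0" for h x by (simp add: R_def)
  have R[measurable]: "R h \<in> borel_measurable \<mu>" for h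
    unfolding R_def[abs_def] by measurable
  have ev: "\<forall>\<^sub>F h in at 0. integrable \<mu> (R h)" "(\<lambda>h. \<integral>x. R h x \<partial>\<mu>) \<in> o[at 0](\<lambda>h. (norm h)\<^sup>2)"
    using dqm by (simp_all add: dqm_at_def R_def[abs_def] a_def b_def Let_def)
  \<comment> \<open>Little-o with constant 1 bounds the remainder by
    \<open>(norm h)\<^sup>2\<close>. The filter omits \<open>h = 0\<close>, hence the later case
    distinction.\<close>
  from landau_o.smallD[OF ev(2), of 1] ev(1)
  have "\<forall>\<^sub>F h in at 0. integrable \<mu> (R h) \<and> (\<integral>x. R h x \<partial>\<mu>) \<le> (norm h)\<^sup>2"
    by (auto elim: eventually_elim2)
  then obtain r1 where r1: "r1 > 0"
    "\<And>h. h \<noteq> 0 \<Longrightarrow> norm h < r1 \<Longrightarrow> integrable \<mu> (R h) \<and> (\<integral>x. R h x \<partial>\<mu>) \<le> (norm h)\<^sup>2"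
    by (auto simp: eventually_at)
  obtain r2 where r2: "r2 > 0" "ball \<theta>\<^sub>0 r2 \<subseteq> \<Theta>"
    using \<theta>\<^sub>0 by (auto simp: mem_interior)
  define r where "r = min r1 r2"
  have r: "r > 0" using r1 r2 by (simp add: r_def)
  have \<Theta>: "\<theta>\<^sub>0 + h \<in> \<Theta>" if "norm h < r" for h
    using that r2 by (auto simp: subset_eq dist_norm r_def)
  have \<theta>\<^sub>0\<Theta>: "\<theta>\<^sub>0 \<in> \<Theta>" using \<theta>\<^sub>0 interior_subset by auto
  have intR: "(\<integral>\<^sup>+x. ennreal (R h x) \<partial>\<mu>) \<le> ennreal ((norm h)\<^sup>2)" if "h \<noteq> 0" "norm h < r" for h
    using r1(2)[of h] that R0 by (subst nn_integral_eq_integral) (auto simp: r_def intro!: ennreal_leI)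
  have intP: "(\<integral>\<^sup>+x. f x \<partial>P (\<theta>\<^sub>0 + h)) = (\<integral>\<^sup>+x. ennreal ((b h x)\<^sup>2) * f x \<partial>\<mu>)"
    if "norm h < r" "f \<in> borel_measurable \<mu>" for h f
    unfolding b_def using that P ac \<Theta> by (intro nn_integral_sqrt_dens \<mu>) auto
  have b0: "b 0 = a" by (simp add: a_def b_def)
  have int1: "(\<integral>\<^sup>+x. ennreal ((b h x)\<^sup>2) \<partial>\<mu>) = 1" if "norm h < r" for h
    using intP[OF that, of "\<lambda>_. 1"] prob_space.emeasure_space_1[OF P(1)[OF \<Theta>[OF that]]] by simp
  have int0: "(\<integral>\<^sup>+x. ennreal ((a x)\<^sup>2) \<partial>\<mu>) = 1" using int1[of 0] r by (simp add: b0)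
  have nth[measurable]: "(\<lambda>x. score x $ i) \<in> borel_measurable \<mu>" for i
    unfolding cart_eq_inner_axis by measurable
  have norm_sq: "(norm v)\<^sup>2 = (\<Sum>i\<in>UNIV. (v $ i)\<^sup>2)" for v :: "real ^ 'd"
    unfolding power2_norm_eq_inner inner_vec_def by (simp add: power2_eq_square)
  \<comment> \<open>As \<open>a\<^sup>2\<close> is the density at \<open>\<theta>\<^sub>0\<close>,
    this is the second moment of the score, the trace of the Fisher information. Each coordinate is
    finite since, for a fixed small \<open>h\<close> along that axis, the linear term is a
    combination of \<open>b h\<close>, \<open>a\<close> and the remainder, which are all
    square-integrable.\<close>
  define S where "S = (\<integral>\<^sup>+x. ennreal ((norm (score x))\<^sup>2 * (a x)\<^sup>2) \<partial>\<mu>)"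
  have "S = (\<integral>\<^sup>+x. (\<Sum>i\<in>UNIV. ennreal ((score x $ i)\<^sup>2 * (a x)\<^sup>2)) \<partial>\<mu>)"
    unfolding S_def norm_sq by (simp add: sum_distrib_right)
  also have "\<dots> = (\<Sum>i\<in>UNIV. (\<integral>\<^sup>+x. ennreal ((score x $ i)\<^sup>2 * (a x)\<^sup>2) \<partial>\<mu>))"
    by (intro nn_integral_sum) simp
  also have "\<dots> < \<infinity>"
  proof -
    have "(\<integral>\<^sup>+x. ennreal ((score x $ i)\<^sup>2 * (a x)\<^sup>2) \<partial>\<mu>) < \<infinity>" for i
    proof -
      define t where "t = r / 2"
      define h :: "real ^ 'd" where "h = t *\<^sub>R axis i 1"
      have t: "t > 0" using r by (simp add: t_def)
      have "norm h = t" using t by (simp add: h_def norm_axis_1)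
      then have h: "norm h < r" "h \<noteq> 0" using r by (auto simp: t_def)
      have "h \<bullet> score x = t * score x $ i" for x by (simp add: h_def inner_axis')
      then have "(score x $ i)\<^sup>2 * (a x)\<^sup>2 \<le> (12 / t\<^sup>2) * (R h x + (b h x)\<^sup>2 + (a x)\<^sup>2)" for x
      proof -
        define z where "z = b h x - a x - 1 / 2 * (t * score x $ i) * a x"
        have "t * score x $ i * a x = 2 * (b h x - a x - z)" by (simp add: z_def)
        then have "t\<^sup>2 * ((score x $ i)\<^sup>2 * (a x)\<^sup>2) = 4 * (b h x - a x - z)\<^sup>2"
          by (metis (no_types, lifting) mult.assoc power2_eq_square power_mult_distrib four_x_squared)
        \<comment> \<open>The factor is 4 times 3, from Cauchy-Schwarz for a sum of three
          terms.\<close>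
        also have "\<dots> \<le> 12 * (z\<^sup>2 + (b h x)\<^sup>2 + (a x)\<^sup>2)"
        proof -
          have "0 \<le> (b h x + a x)\<^sup>2 + (b h x + z)\<^sup>2 + (a x - z)\<^sup>2" by simp
          then show ?thesis by (simp add: power2_eq_square algebra_simps)
        qed
        finally show ?thesis
          using t \<open>h \<bullet> score x = t * score x $ i\<close> by (simp add: R_def z_def field_simps)
      qed
      then have "(\<integral>\<^sup>+x. ennreal ((score x $ i)\<^sup>2 * (a x)\<^sup>2) \<partial>\<mu>) \<le>
         (\<integral>\<^sup>+x. ennreal (12 / t\<^sup>2) * (ennreal (R h x) + ennreal ((b h x)\<^sup>2) + ennreal ((a x)\<^sup>2)) \<partial>\<mu>)"
        by (intro nn_integral_mono) (simp add: R_def ennreal_mult[symmetric] ennreal_plus[symmetric] ennreal_leI del: ennreal_plus)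
      also have "\<dots> = ennreal (12 / t\<^sup>2) * ((\<integral>\<^sup>+x. ennreal (R h x) \<partial>\<mu>) + 1 + 1)"
        using int0 int1[OF h(1)] by (simp add: nn_integral_cmult nn_integral_add)
      also have "\<dots> < \<infinity>"
        using le_less_trans[OF intR[OF h(2,1)] ennreal_less_top] by (simp add: ennreal_mult_less_top)
      finally show ?thesis .
    qed
    then show ?thesis by simp
  qed
  finally have S: "S < \<infinity>" .
  show ?thesis
  \<comment> \<open>In units of \<open>n = norm h\<close>, the remainder contributes 1, the score
    \<open>S / 4\<close>, and the two unit masses of \<open>a\<^sup>2\<close> and
    \<open>b\<^sup>2\<close> together 2.\<close>
  proof (rule that[of "3 + enn2real S / 4" r])
    fix \<theta> and f :: "'x \<Rightarrow> ennreal"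
    assume \<theta>: "norm (\<theta> - \<theta>\<^sub>0) < r" and f[measurable]: "f \<in> borel_measurable \<mu>" "\<And>x. f x \<le> 1"
    define h where "h = \<theta> - \<theta>\<^sub>0"
    define n where "n = norm h"
    have \<theta>_eq: "\<theta> = \<theta>\<^sub>0 + h" by (simp add: h_def)
    show "(\<integral>\<^sup>+x. f x \<partial>P \<theta>\<^sub>0) \<le> (\<integral>\<^sup>+x. f x \<partial>P \<theta>) + ennreal ((3 + enn2real S / 4) * norm (\<theta> - \<theta>\<^sub>0))"
    proof (cases "h = 0")
      case True
      then show ?thesis by (simp add: h_def)
    next
      case False
      then have n: "n > 0" by (simp add: n_def)
      have h: "norm h < r" using \<theta> by (simp add: h_def)
      let ?E = "\<lambda>x. (1 / n) * R h x + (n / 4) * ((norm (score x))\<^sup>2 * (a x)\<^sup>2) + n * (a x)\<^sup>2 + n * (b h x)\<^sup>2"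
      have E: "(a x)\<^sup>2 \<le> (b h x)\<^sup>2 + ?E x" for x
      proof -
        define u where "u = h \<bullet> score x"
        have "\<bar>u\<bar> \<le> n * norm (score x)" unfolding u_def n_def by (rule Cauchy_Schwarz_ineq2)
        then have "u\<^sup>2 \<le> (n * norm (score x))\<^sup>2" using abs_le_square_iff[of u "n * norm (score x)"] n by simp
        then have u: "u\<^sup>2 * (a x)\<^sup>2 \<le> n\<^sup>2 * ((norm (score x))\<^sup>2 * (a x)\<^sup>2)"
          using mult_right_mono[of "u\<^sup>2" "(n * norm (score x))\<^sup>2" "(a x)\<^sup>2"] by (simp add: power_mult_distrib mult.assoc)
        have "0 \<le> ((b h x - a x - 1 / 2 * u * a x) - 1 / 2 * u * a x)\<^sup>2" by simp
        then have d: "(b h x - a x)\<^sup>2 \<le> 2 * R h x + 1 / 2 * (u\<^sup>2 * (a x)\<^sup>2)"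
          by (simp add: R_def u_def[symmetric] power2_eq_square algebra_simps)
        have s: "(a x + b h x)\<^sup>2 \<le> 2 * (a x)\<^sup>2 + 2 * (b h x)\<^sup>2"
          using sum_squares_bound[of "a x" "b h x"] by (simp add: power2_sum)
        \<comment> \<open>AM-GM for \<open>(a - b) * (a + b)\<close>, weighted so that both terms integrate to \<open>O(n)\<close>\<close>
        have "0 \<le> ((b h x - a x) + n * (a x + b h x))\<^sup>2" by simp
        then have "2 * n * ((a x)\<^sup>2 - (b h x)\<^sup>2) \<le> (b h x - a x)\<^sup>2 + n\<^sup>2 * (a x + b h x)\<^sup>2"
          by (simp add: power2_eq_square algebra_simps)
        also have "\<dots> \<le> (2 * R h x + 1 / 2 * (n\<^sup>2 * ((norm (score x))\<^sup>2 * (a x)\<^sup>2))) + n\<^sup>2 * (2 * (a x)\<^sup>2 + 2 * (b h x)\<^sup>2)"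
          using d u s by (intro add_mono mult_left_mono) auto
        also have "\<dots> = 2 * n * ?E x" using n by (simp add: field_simps power2_eq_square)
        finally have "(a x)\<^sup>2 - (b h x)\<^sup>2 \<le> ?E x" using n by simp
        then show ?thesis by simp
      qed
      have "(\<integral>\<^sup>+x. f x \<partial>P \<theta>\<^sub>0) = (\<integral>\<^sup>+x. ennreal ((a x)\<^sup>2) * f x \<partial>\<mu>)"
        using intP[of 0 f] r by (simp add: b0)
      also have "\<dots> \<le> (\<integral>\<^sup>+x. ennreal ((b h x)\<^sup>2) * f x + (ennreal (1 / n) * ennreal (R h x) +
         ennreal (n / 4) * ennreal ((norm (score x))\<^sup>2 * (a x)\<^sup>2) + ennreal n * ennreal ((a x)\<^sup>2) + ennreal n * ennreal ((b h x)\<^sup>2)) \<partial>\<mu>)"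
      proof (rule nn_integral_mono)
        fix x
        have "ennreal ((a x)\<^sup>2) * f x \<le> ennreal ((b h x)\<^sup>2 + ?E x) * f x"
          using E by (intro mult_right_mono ennreal_leI) auto
        also have "ennreal ((b h x)\<^sup>2 + ?E x) = ennreal ((b h x)\<^sup>2) + ennreal (?E x)"
          using n R0 by (intro ennreal_plus) auto
        \<comment> \<open>The factor \<open>f\<close> is kept on the density at
          \<open>\<theta>\<close>, where it produces the integral under \<open>P \<theta>\<close>,
          and is bounded by 1 on the error term.\<close>
        also have "(ennreal ((b h x)\<^sup>2) + ennreal (?E x)) * f x \<le> ennreal ((b h x)\<^sup>2) * f x + ennreal (?E x) * 1"
          unfolding distrib_right using f(2) by (intro add_left_mono mult_left_mono) auto
        also have "ennreal (?E x) * 1 = ennreal (1 / n) * ennreal (R h x) +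
         ennreal (n / 4) * ennreal ((norm (score x))\<^sup>2 * (a x)\<^sup>2) + ennreal n * ennreal ((a x)\<^sup>2) + ennreal n * ennreal ((b h x)\<^sup>2)"
          using n R0 by (simp add: ennreal_mult[symmetric] ennreal_plus[symmetric] del: ennreal_plus)
        finally show "ennreal ((a x)\<^sup>2) * f x \<le> ennreal ((b h x)\<^sup>2) * f x + (ennreal (1 / n) * ennreal (R h x) +
         ennreal (n / 4) * ennreal ((norm (score x))\<^sup>2 * (a x)\<^sup>2) + ennreal n * ennreal ((a x)\<^sup>2) + ennreal n * ennreal ((b h x)\<^sup>2))" .
      qed
      also have "\<dots> = (\<integral>\<^sup>+x. f x \<partial>P \<theta>) + (ennreal (1 / n) * (\<integral>\<^sup>+x. ennreal (R h x) \<partial>\<mu>) + ennreal (n / 4) * S + ennreal n + ennreal n)"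
        using int0 int1[OF h] intP[OF h f(1)] by (simp add: nn_integral_add nn_integral_cmult S_def \<theta>_eq)
      also have "\<dots> \<le> (\<integral>\<^sup>+x. f x \<partial>P \<theta>) + (ennreal (1 / n) * ennreal (n\<^sup>2) + ennreal (n / 4) * ennreal (enn2real S) + ennreal n + ennreal n)"
        using intR[OF False h] S by (intro add_left_mono add_right_mono add_mono mult_left_mono) (auto simp: n_def less_top)
      also have "ennreal (1 / n) * ennreal (n\<^sup>2) + ennreal (n / 4) * ennreal (enn2real S) + ennreal n + ennreal n =
          ennreal ((3 + enn2real S / 4) * n)"
        using n by (simp add: ennreal_mult[symmetric] ennreal_plus[symmetric] power2_eq_square algebra_simps del: ennreal_plus)
      finally show ?thesis by (simp add: n_def h_def)
    qed
  qed (use r in auto)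
qed

section \<open>Exponentially powerful tests\<close>

lemma measurable_block:
  assumes "j < n div k"
  shows "(\<lambda>x. \<lambda>i\<in>{..<k}. x (j * k + i)) \<in> sample_space M n \<rightarrow>\<^sub>M sample_space M k"
proof (intro measurable_restrict measurable_component_singleton)
  fix i assume "i \<in> {..<k}"
  then have "j * k + i < Suc j * k" by simp
  also have "\<dots> \<le> (n div k) * k" using assms by (intro mult_le_mono1) simp
  also have "\<dots> \<le> n" by simp
  finally show "j * k + i \<in> {..<n}" by simp
qed

text \<open>Disjoint blocks of coordinates are independent, and each block, reindexed, has law
  \<open>iid_law Q k\<close>. Coordinates outside the blocks integrate to 1.\<close>

lemma nn_integral_prod_blocks:
  fixes f :: "(nat \<Rightarrow> 'x) \<Rightarrow> ennreal"
  assumes Q: "prob_space Q" and f: "f \<in> borel_measurable (iid_law Q k)" and n: "m * k \<le> n"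
  shows "(\<integral>\<^sup>+x. (\<Prod>j<m. f (\<lambda>i\<in>{..<k}. x (j * k + i))) \<partial>iid_law Q n) = (\<integral>\<^sup>+x. f x \<partial>iid_law Q k) ^ m"
proof (cases "m * k = 0")
  \<comment> \<open>Either there are no factors, or the blocks are empty and \<open>f\<close> is
    evaluated at a single point. The independence argument below needs a nonempty index set.\<close>
  case True
  interpret prob_space "iid_law Q n" using Q by (intro prob_space_PiM)
  show ?thesis using True
    by (auto simp: PiM_empty emeasure_space_1[simplified] restrict_def nn_integral_count_space_finite)
next
  case False
  interpret Qn: prob_space "iid_law Q n" using Q by (intro prob_space_PiM)
  define L where "L j = {j * k..<j * k + k}" for j
  define X where "X j x = f (\<lambda>i\<in>{..<k}. x (j * k + i))" for j x
  have sub: "L j \<subseteq> {..<n}" if "j < m" for j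
  proof -
    have "j * k + k \<le> m * k" using that mult_le_mono1[of "Suc j" m k] by simp
    then show ?thesis using n by (auto simp: L_def)
  qed
  have "Qn.indep_vars (\<lambda>_. Q) (\<lambda>i x. x i) {..<n}"
  proof (subst Qn.indep_vars_iff_distr_eq_PiM')
    have "0 < n" using False n by linarith
    then show "{..<n} \<noteq> {}" by (simp add: lessThan_empty_iff)
    have "distr (iid_law Q n) (iid_law Q n) (\<lambda>x. restrict x {..<n}) = distr (iid_law Q n) (iid_law Q n) (\<lambda>x. x)"
      by (intro distr_cong) (auto simp: space_PiM)
    also have "\<dots> = (\<Pi>\<^sub>M i\<in>{..<n}. distr (iid_law Q n) Q (\<lambda>x. x i))"
      using Q by (auto intro!: PiM_cong distr_PiM_component[symmetric] simp: distr_id)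
    finally show "distr (iid_law Q n) (iid_law Q n) (\<lambda>x. \<lambda>i\<in>{..<n}. x i) =
        (\<Pi>\<^sub>M i\<in>{..<n}. distr (iid_law Q n) Q (\<lambda>x. x i))" .
  qed auto
  then have "Qn.indep_vars (\<lambda>j. PiM (L j) (\<lambda>_. Q)) (\<lambda>j x. restrict (\<lambda>i. x i) (L j)) {..<m}"
  proof (rule Qn.indep_vars_restrict)
    \<comment> \<open>Division by \<open>k\<close> recovers the number of the block from an
      index.\<close>
    show "disjoint_family_on L {..<m}"
      unfolding disjoint_family_on_def
    proof (intro ballI impI)
      fix a b :: nat assume "a \<noteq> b"
      show "L a \<inter> L b = {}"
      proof (rule ccontr)
        assume "L a \<inter> L b \<noteq> {}"
        then obtain i where "i \<in> L a" "i \<in> L b" by auto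
        then have "i div k = a" "i div k = b"
          by (auto simp: L_def intro!: div_nat_eqI simp: mult.commute)
        with \<open>a \<noteq> b\<close> show False by simp
      qed
    qed
  qed (use sub in auto)
  then have "Qn.indep_vars (\<lambda>_. borel) (\<lambda>j x. X j (restrict (\<lambda>i. x i) (L j))) {..<m}"
  proof (rule Qn.indep_vars_compose2)
    fix j assume "j \<in> {..<m}"
    have "(\<lambda>x. \<lambda>i\<in>{..<k}. x (j * k + i)) \<in> PiM (L j) (\<lambda>_. Q) \<rightarrow>\<^sub>M iid_law Q k"
      by (intro measurable_restrict measurable_component_singleton) (auto simp: L_def)
    then show "X j \<in> borel_measurable (PiM (L j) (\<lambda>_. Q))"
      unfolding X_def using f by (rule measurable_compose)
  qed
  moreover have "X j (restrict (\<lambda>i. x i) (L j)) = X j x" for j x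
    unfolding X_def by (rule arg_cong[where f=f]) (auto simp: L_def)
  ultimately have "Qn.indep_vars (\<lambda>_. borel) X {..<m}" by simp
  then have "(\<integral>\<^sup>+x. (\<Prod>j<m. X j x) \<partial>iid_law Q n) = (\<Prod>j<m. \<integral>\<^sup>+x. X j x \<partial>iid_law Q n)"
    by (intro Qn.indep_vars_nn_integral) auto
  also have "\<dots> = (\<Prod>j<m. \<integral>\<^sup>+x. f x \<partial>iid_law Q k)"
  proof (rule prod.cong[OF refl])
    fix j assume "j \<in> {..<m}"
    then have j: "(\<lambda>i. j * k + i) \<in> {..<k} \<rightarrow> {..<n}" using sub[of j] by (auto simp: L_def subset_eq)
    have "(\<integral>\<^sup>+x. X j x \<partial>iid_law Q n) =
      (\<integral>\<^sup>+x. f x \<partial>distr (iid_law Q n) (iid_law Q k) (\<lambda>x. \<lambda>i\<in>{..<k}. x (j * k + i)))"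
      unfolding X_def using f j
      by (intro nn_integral_distr[symmetric] measurable_restrict measurable_component_singleton) auto
    also have "distr (iid_law Q n) (iid_law Q k) (\<lambda>x. \<lambda>i\<in>{..<k}. x (j * k + i)) = iid_law Q k"
      using Q j by (intro distr_PiM_reindex) (auto simp: inj_on_def)
    finally show "(\<integral>\<^sup>+x. X j x \<partial>iid_law Q n) = (\<integral>\<^sup>+x. f x \<partial>iid_law Q k)" .
  qed
  finally show ?thesis by (simp add: X_def)
qed

text \<open>On the unit interval the convex function \<open>3 powr y\<close> lies below its chord
  \<open>1 + 2 * y\<close>, so a mean of at most 1/4 gives \<open>(3 / 2) / sqrt 3\<close>, which is
  below 1. Base 3 is optimal here: base b would give (b + 3) / (4 sqrt b), minimal at b = 3.\<close>

lemma (in prob_space) nn_integral_powr_le: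
  fixes Y :: "'a \<Rightarrow> real"
  assumes Y: "Y \<in> borel_measurable M" "\<And>x. x \<in> space M \<Longrightarrow> Y x \<in> {0..1}"
    and E: "(\<integral>x. Y x \<partial>M) \<le> 1 / 4"
  shows "(\<integral>\<^sup>+x. ennreal (3 powr (Y x - 1 / 2)) \<partial>M) \<le> ennreal (sqrt 3 / 2)"
proof -
  have int: "integrable M Y"
    using Y by (intro integrable_const_bound[where B=1]) (auto intro!: AE_I2)
  have "3 powr (y - 1 / 2) \<le> (1 + 2 * y) / sqrt 3" if "y \<in> {0..1}" for y :: real
  proof -
    have "exp ((1 - y) *\<^sub>R 0 + y *\<^sub>R ln 3) \<le> (1 - y) * exp (0::real) + y * exp (ln 3)"
      using that by (intro convex_onD[OF exp_convex]) auto
    then have "3 powr y \<le> 1 + 2 * y" by (simp add: powr_def)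
    moreover have "3 powr (y - 1 / 2) = 3 powr y / sqrt 3"
      by (simp add: powr_diff powr_half_sqrt)
    ultimately show ?thesis by (simp add: divide_right_mono)
  qed
  then have "(\<integral>\<^sup>+x. ennreal (3 powr (Y x - 1 / 2)) \<partial>M) \<le> (\<integral>\<^sup>+x. ennreal ((1 + 2 * Y x) / sqrt 3) \<partial>M)"
    using Y by (intro nn_integral_mono ennreal_leI) blast
  also have "\<dots> = ennreal (\<integral>x. (1 + 2 * Y x) / sqrt 3 \<partial>M)"
    using Y int by (intro nn_integral_eq_integral) (auto intro!: AE_I2)
  also have "(\<integral>x. (1 + 2 * Y x) / sqrt 3 \<partial>M) = (1 + 2 * (\<integral>x. Y x \<partial>M)) / sqrt 3"
    using int by (simp add: prob_space)
  also have "\<dots> \<le> (3 / 2) / sqrt 3"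
    using E by (intro divide_right_mono) auto
  also have "(3 / 2) / sqrt 3 = sqrt 3 / 2"
    by (simp add: field_simps)
  finally show ?thesis by (simp add: ennreal_leI)
qed

text \<open>Markov's inequality bounds the probability by the mean of the product, which by
  independence of the blocks is at most \<open>sqrt 3 / 2\<close> to the power
  \<open>n div k\<close>. The prefactor \<open>2 / sqrt 3\<close> pays for the rounding in
  \<open>n div k\<close>.\<close>

lemma emeasure_block_product_ge_1_le:
  fixes Y :: "(nat \<Rightarrow> 'x) \<Rightarrow> real"
  assumes Q: "prob_space Q" and k: "k \<ge> 1"
    and Y: "Y \<in> borel_measurable (iid_law Q k)" "\<And>x. x \<in> space (iid_law Q k) \<Longrightarrow> Y x \<in> {0..1}"
    and E: "(\<integral>x. Y x \<partial>iid_law Q k) \<le> 1 / 4"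
  shows "emeasure (iid_law Q n) {x \<in> space (iid_law Q n).
            1 \<le> (\<Prod>j<n div k. 3 powr (Y (\<lambda>i\<in>{..<k}. x (j * k + i)) - 1 / 2))}
         \<le> ennreal (2 / sqrt 3 * ((sqrt 3 / 2) powr (1 / k)) ^ n)"
proof -
  define m where "m = n div k"
  define q :: real where "q = sqrt 3 / 2"
  have q: "0 < q" "q \<le> 1"
    using real_sqrt_le_mono[of 3 4] by (auto simp: q_def)
  interpret Qk: prob_space "iid_law Q k" using Q by (intro prob_space_PiM)
  define f where "f x = ennreal (3 powr (Y x - 1 / 2))" for x
  have f: "f \<in> borel_measurable (iid_law Q k)" using Y(1) by (simp add: f_def[abs_def])
  have mk: "m * k \<le> n" by (simp add: m_def)
  have "emeasure (iid_law Q n) {x \<in> space (iid_law Q n).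
            1 \<le> (\<Prod>j<m. 3 powr (Y (\<lambda>i\<in>{..<k}. x (j * k + i)) - 1 / 2))} \<le>
        (\<integral>\<^sup>+x. (\<Prod>j<m. f (\<lambda>i\<in>{..<k}. x (j * k + i))) \<partial>iid_law Q n)"
  proof (rule order_trans[OF _ nn_integral_mono[of _ "indicator {x \<in> space (iid_law Q n).
            1 \<le> (\<Prod>j<m. 3 powr (Y (\<lambda>i\<in>{..<k}. x (j * k + i)) - 1 / 2))}"]])
    have "(\<lambda>x. Y (\<lambda>i\<in>{..<k}. x (j * k + i))) \<in> borel_measurable (iid_law Q n)" if "j < m" for j
      using measurable_compose[OF measurable_block Y(1)] that by (simp add: m_def)
    then have "{x \<in> space (iid_law Q n). 1 \<le> (\<Prod>j<m. 3 powr (Y (\<lambda>i\<in>{..<k}. x (j * k + i)) - 1 / 2))}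
       \<in> sets (iid_law Q n)"
      by (intro borel_measurable_le borel_measurable_prod) auto
    then show "emeasure (iid_law Q n) {x \<in> space (iid_law Q n).
      1 \<le> (\<Prod>j<m. 3 powr (Y (\<lambda>i\<in>{..<k}. x (j * k + i)) - 1 / 2))} \<le>
       integral\<^sup>N (iid_law Q n) (indicator {x \<in> space (iid_law Q n).
            1 \<le> (\<Prod>j<m. 3 powr (Y (\<lambda>i\<in>{..<k}. x (j * k + i)) - 1 / 2))})"
      by simp
  next
    fix x
    have "(\<Prod>j<m. f (\<lambda>i\<in>{..<k}. x (j * k + i))) =
        ennreal (\<Prod>j<m. 3 powr (Y (\<lambda>i\<in>{..<k}. x (j * k + i)) - 1 / 2))"
      unfolding f_def by (intro prod_ennreal) simp
    then show "indicator {x \<in> space (iid_law Q n).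
            1 \<le> (\<Prod>j<m. 3 powr (Y (\<lambda>i\<in>{..<k}. x (j * k + i)) - 1 / 2))} x
        \<le> (\<Prod>j<m. f (\<lambda>i\<in>{..<k}. x (j * k + i)))"
      by (auto simp: indicator_def)
  qed
  also have "\<dots> = (\<integral>\<^sup>+x. f x \<partial>iid_law Q k) ^ m"
    using Q f mk by (rule nn_integral_prod_blocks)
  also have "\<dots> \<le> ennreal q ^ m"
    unfolding f_def q_def by (intro power_mono Qk.nn_integral_powr_le Y E) auto
  also have "\<dots> = ennreal (q powr m)"
    using q by (simp add: ennreal_power powr_realpow)
  also have "\<dots> \<le> ennreal (q powr (n / k - 1))"
  proof (intro ennreal_leI powr_mono')
    have "n / k \<le> real (n div k) + 1" using floor_divide_of_nat_eq[of n k, where ?'a=real] by linarith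
    then show "n / k - 1 \<le> real m" by (simp add: m_def)
  qed (use q in auto)
  also have "q powr (n / k - 1) = 1 / q * (q powr (1 / k)) ^ n"
    using q by (simp add: powr_diff powr_powr flip: powr_realpow)
  also have "1 / q = 2 / sqrt 3" by (simp add: q_def)
  finally show ?thesis unfolding m_def q_def .
qed

text \<open>
  The sample is cut into blocks of a fixed size \<open>k\<close>, on which the errors of the test are at most
  \<open>1/4\<close>. The decision is based on the product over all blocks of \<open>3 powr (1/2 - \<phi>)\<close>, whose mean,
  and that of its inverse under the null, are exponentially small; thus Markov's inequality
  replaces large deviation bounds.
\<close>

lemma exponential_tests:
  fixes \<Theta> :: "(real ^ 'd) set" and P :: "real ^ 'd \<Rightarrow> 'b measure"
  assumes model: "P \<in> param_space \<Theta> \<rightarrow>\<^sub>M prob_algebra M" and \<theta>\<^sub>0: "\<theta>\<^sub>0 \<in> \<Theta>"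
    and tests: "uniformly_consistent_tests M \<Theta> P \<theta>\<^sub>0 \<epsilon> \<phi>"
  obtains C \<rho> :: real and W where "C \<ge> 0" "0 < \<rho>" "\<rho> < 1" "\<And>n. W n \<in> sets (sample_space M n)"
    "\<And>n. emeasure (iid_law (P \<theta>\<^sub>0) n) (space (sample_space M n) - W n) \<le> ennreal (C * \<rho> ^ n)"
    "\<And>n \<theta>. \<theta> \<in> \<Theta> \<Longrightarrow> norm (\<theta> - \<theta>\<^sub>0) \<ge> \<epsilon> \<Longrightarrow> emeasure (iid_law (P \<theta>) n) (W n) \<le> ennreal (C * \<rho> ^ n)"
proof -
  have P: "prob_space (P \<theta>)" "sets (P \<theta>) = sets M" if "\<theta> \<in> \<Theta>" for \<theta>
    using measurable_space[OF model, of \<theta>] that by (auto simp: space_prob_algebra space_restrict_space)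
  have sP: "sets (iid_law (P \<theta>) n) = sets (sample_space M n)" if "\<theta> \<in> \<Theta>" for \<theta> n
    using P[OF that] by (intro sets_PiM_cong) auto
  note spP = sets_eq_imp_space_eq[OF sP]
  have ev: "\<forall>\<^sub>F n in sequentially. n \<ge> 1 \<and> (\<integral>x. \<phi> n x \<partial>iid_law (P \<theta>\<^sub>0) n) < 1 / 4 \<and>
    (SUP \<theta>\<in>{\<theta>\<in>\<Theta>. norm (\<theta> - \<theta>\<^sub>0) \<ge> \<epsilon>}. ennreal (\<integral>x. 1 - \<phi> n x \<partial>iid_law (P \<theta>) n)) < ennreal (1 / 4)"
    using tests unfolding uniformly_consistent_tests_def
    by (intro eventually_conj eventually_ge_at_top order_tendstoD(2)) auto
  \<comment> \<open>A single sample size at which both errors are below 1/4 suffices; it becomes the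
    block length.\<close>
  then obtain k where k: "k \<ge> 1" "(\<integral>x. \<phi> k x \<partial>iid_law (P \<theta>\<^sub>0) k) < 1 / 4"
    "(SUP \<theta>\<in>{\<theta>\<in>\<Theta>. norm (\<theta> - \<theta>\<^sub>0) \<ge> \<epsilon>}. ennreal (\<integral>x. 1 - \<phi> k x \<partial>iid_law (P \<theta>) k)) < ennreal (1 / 4)"
    by (auto dest: eventually_happens)
  have \<phi>: "\<phi> k \<in> borel_measurable (sample_space M k)" "\<And>x. x \<in> space (sample_space M k) \<Longrightarrow> \<phi> k x \<in> {0..1}"
    using tests k(1) by (auto simp: uniformly_consistent_tests_def)
  have far: "(\<integral>x. 1 - \<phi> k x \<partial>iid_law (P \<theta>) k) \<le> 1 / 4" if "\<theta> \<in> \<Theta>" "norm (\<theta> - \<theta>\<^sub>0) \<ge> \<epsilon>" for \<theta>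
  proof (rule ccontr)
    assume "\<not> ?thesis"
    then have "ennreal (1 / 4) \<le> ennreal (\<integral>x. 1 - \<phi> k x \<partial>iid_law (P \<theta>) k)"
      by (intro ennreal_leI) simp
    also have "\<dots> \<le> (SUP \<theta>\<in>{\<theta>\<in>\<Theta>. norm (\<theta> - \<theta>\<^sub>0) \<ge> \<epsilon>}. ennreal (\<integral>x. 1 - \<phi> k x \<partial>iid_law (P \<theta>) k))"
      using that by (intro SUP_upper) auto
    finally show False using k(3) by simp
  qed
  define b where "b x j = \<phi> k (\<lambda>i\<in>{..<k}. x (j * k + i)) - 1 / 2" for x :: "nat \<Rightarrow> 'b" and j
  have b: "(\<lambda>x. b x j) \<in> borel_measurable (sample_space M n)" if "j < n div k" for j n
    unfolding b_def using measurable_compose[OF measurable_block[OF that] \<phi>(1)] by simp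
  \<comment> \<open>The acceptance region: the average of the test over the blocks is at most 1/2.
    For \<open>n < k\<close> the product is empty and \<open>W n\<close> is the whole space, which
    agrees with the claimed bounds because \<open>2 / sqrt 3 * q ^ n\<close> then exceeds 1.\<close>
  define W where "W n = {x \<in> space (sample_space M n). 1 \<le> (\<Prod>j<n div k. 3 powr (- b x j))}" for n
  define q :: real where "q = (sqrt 3 / 2) powr (1 / k)"
  have "sqrt 3 < 2" using real_sqrt_less_mono[of 3 4] by simp
  then have "q < 1 powr (1 / k)" unfolding q_def using k(1) by (intro powr_less_mono2) auto
  then have q: "0 < q" "q < 1" by (auto simp: q_def)
  show ?thesis
  proof (rule that[of "2 / sqrt 3" q W])
    show "W n \<in> sets (sample_space M n)" for n
      unfolding W_def using b by (intro borel_measurable_le borel_measurable_prod) auto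
  next
    fix n
    \<comment> \<open>On the rejection region the reciprocal product is at least 1, so the block
      bound applies with \<open>\<phi> k\<close> as \<open>Y\<close>.\<close>
    have "emeasure (iid_law (P \<theta>\<^sub>0) n) (space (sample_space M n) - W n) \<le>
        emeasure (iid_law (P \<theta>\<^sub>0) n) {x \<in> space (iid_law (P \<theta>\<^sub>0) n). 1 \<le> (\<Prod>j<n div k. 3 powr (b x j))}"
    proof (rule emeasure_mono)
      have "1 \<le> (\<Prod>j<n div k. 3 powr (b x j))" if "(\<Prod>j<n div k. 3 powr (- b x j)) < 1" for x
      proof -
        have "(\<Prod>j<n div k. 3 powr (- b x j)) * (\<Prod>j<n div k. 3 powr (b x j)) = 1"
          by (simp flip: prod.distrib powr_add)
        moreover have "0 < (\<Prod>j<n div k. 3 powr (b x j))"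
          by (intro prod_pos) auto
        ultimately show ?thesis using that
          by (metis less_eq_real_def linorder_not_le mult_less_cancel_right2 mult_1 order_less_irrefl)
      qed
      then show "space (sample_space M n) - W n \<subseteq>
          {x \<in> space (iid_law (P \<theta>\<^sub>0) n). 1 \<le> (\<Prod>j<n div k. 3 powr (b x j))}"
        by (auto simp: W_def spP[OF \<theta>\<^sub>0] not_le)
      show "{x \<in> space (iid_law (P \<theta>\<^sub>0) n). 1 \<le> (\<Prod>j<n div k. 3 powr (b x j))} \<in> sets (iid_law (P \<theta>\<^sub>0) n)"
        using b[unfolded measurable_cong_sets[OF sP[OF \<theta>\<^sub>0, symmetric] refl]]
        by (intro borel_measurable_le borel_measurable_prod) auto
    qed
    also have "\<dots> \<le> ennreal (2 / sqrt 3 * q ^ n)"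
      unfolding q_def b_def using \<phi> k(2)
      by (intro emeasure_block_product_ge_1_le P \<theta>\<^sub>0 k(1))
        (auto simp: measurable_cong_sets[OF sP[OF \<theta>\<^sub>0] refl] spP[OF \<theta>\<^sub>0])
    finally show "emeasure (iid_law (P \<theta>\<^sub>0) n) (space (sample_space M n) - W n) \<le> ennreal (2 / sqrt 3 * q ^ n)" .
  next
    fix n \<theta> assume \<theta>: "\<theta> \<in> \<Theta>" "norm (\<theta> - \<theta>\<^sub>0) \<ge> \<epsilon>"
    \<comment> \<open>Reversing the sign of the centred test replaces \<open>\<phi> k\<close> by
      \<open>1 - \<phi> k\<close>, whose mean is small at parameters far from
      \<open>\<theta>\<^sub>0\<close>.\<close>
    have eq: "W n = {x \<in> space (iid_law (P \<theta>) n).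
        1 \<le> (\<Prod>j<n div k. 3 powr ((1 - \<phi> k (\<lambda>i\<in>{..<k}. x (j * k + i))) - 1 / 2))}"
      by (simp add: W_def b_def spP[OF \<theta>(1)] algebra_simps)
    show "emeasure (iid_law (P \<theta>) n) (W n) \<le> ennreal (2 / sqrt 3 * q ^ n)"
      unfolding q_def eq using \<phi>
      by (intro emeasure_block_product_ge_1_le P \<theta> far k(1))
        (auto simp: measurable_cong_sets[OF sP[OF \<theta>(1)] refl] spP[OF \<theta>(1)])
  qed (use q in auto)
qed

section \<open>Prior mass of balls\<close>

text \<open>By continuity the density is at least half its value at \<open>\<theta>\<^sub>0\<close>
  on a small ball, and the volume of balls scales with the power \<open>CARD('d)\<close> of the
  radius.\<close>

lemma emeasure_ball_density_ge:
  fixes \<theta>\<^sub>0 :: "real ^ 'd"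
  assumes \<theta>\<^sub>0: "\<theta>\<^sub>0 \<in> interior \<Theta>" and sets: "sets prior = sets (param_space \<Theta>)"
    and d: "distr prior borel (\<lambda>\<theta>. \<theta>) = density lborel (\<lambda>\<theta>. ennreal (\<pi> \<theta>))"
    and \<pi>: "\<pi> \<in> borel_measurable borel" "\<And>\<theta>. \<pi> \<theta> \<ge> 0"
    and U: "open U" "\<theta>\<^sub>0 \<in> U" "continuous_on U \<pi>" and pos: "\<pi> \<theta>\<^sub>0 > 0"
  obtains c r\<^sub>0 :: real where "c > 0" "r\<^sub>0 > 0"
    "\<And>r. 0 < r \<Longrightarrow> r \<le> r\<^sub>0 \<Longrightarrow> ball \<theta>\<^sub>0 r \<subseteq> \<Theta> \<and> ball \<theta>\<^sub>0 r \<in> sets prior \<and>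
       emeasure prior (ball \<theta>\<^sub>0 r) \<ge> ennreal (c * r ^ CARD('d))"
proof -
  have "open (U \<inter> \<pi> -` {\<pi> \<theta>\<^sub>0 / 2<..})" using U by (intro continuous_open_preimage) auto
  moreover have "\<theta>\<^sub>0 \<in> U \<inter> \<pi> -` {\<pi> \<theta>\<^sub>0 / 2<..}" using U pos by simp
  ultimately obtain r1 where r1: "r1 > 0" "ball \<theta>\<^sub>0 r1 \<subseteq> U \<inter> \<pi> -` {\<pi> \<theta>\<^sub>0 / 2<..}"
    by (rule openE)
  obtain r2 where r2: "r2 > 0" "ball \<theta>\<^sub>0 r2 \<subseteq> \<Theta>"
    using \<theta>\<^sub>0 by (auto simp: mem_interior)
  define v where "v = measure lborel (ball (0 :: real ^ 'd) 1)"
  have v: "v > 0" unfolding v_def by (rule content_ball_pos) simp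
  show ?thesis
  proof (rule that[of "\<pi> \<theta>\<^sub>0 / 2 * v" "min r1 r2"])
    fix r :: real assume r: "0 < r" "r \<le> min r1 r2"
    have sub: "ball \<theta>\<^sub>0 r \<subseteq> \<Theta>" using r r2 by auto
    \<comment> \<open>\<open>\<Theta>\<close> need not be Borel, but a ball inside it is its own
      trace on \<open>\<Theta>\<close>.\<close>
    then have "ball \<theta>\<^sub>0 r = \<Theta> \<inter> ball \<theta>\<^sub>0 r" by auto
    then have B: "ball \<theta>\<^sub>0 r \<in> sets prior"
      unfolding sets sets_restrict_space by (rule image_eqI) simp
    have sp: "space prior = \<Theta>" using sets_eq_imp_space_eq[OF sets] by (simp add: space_restrict_space)
    have id: "(\<lambda>\<theta>. \<theta>) \<in> prior \<rightarrow>\<^sub>M borel"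
      unfolding measurable_cong_sets[OF sets refl] by (rule measurable_restrict_space1) simp
    have "ennreal (\<pi> \<theta>\<^sub>0 / 2 * v * r ^ CARD('d)) = ennreal (\<pi> \<theta>\<^sub>0 / 2) * ennreal (measure lborel (ball \<theta>\<^sub>0 r))"
      using pos r by (subst content_ball_conv_unit_ball) (auto simp: v_def ennreal_mult[symmetric] mult_ac)
    also have "\<dots> = (\<integral>\<^sup>+\<theta>. ennreal (\<pi> \<theta>\<^sub>0 / 2) * indicator (ball \<theta>\<^sub>0 r) \<theta> \<partial>lborel)"
      using emeasure_bounded_finite[OF bounded_ball, of \<theta>\<^sub>0 r]
      by (simp add: nn_integral_cmult_indicator emeasure_eq_ennreal_measure)
    also have "\<dots> \<le> (\<integral>\<^sup>+\<theta>. ennreal (\<pi> \<theta>) * indicator (ball \<theta>\<^sub>0 r) \<theta> \<partial>lborel)"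
    proof (intro nn_integral_mono)
      fix \<theta>
      have "\<pi> \<theta>\<^sub>0 / 2 \<le> \<pi> \<theta>" if "\<theta> \<in> ball \<theta>\<^sub>0 r"
        using r r1(2) that by (auto simp: subset_eq less_imp_le)
      then show "ennreal (\<pi> \<theta>\<^sub>0 / 2) * indicator (ball \<theta>\<^sub>0 r) \<theta> \<le> ennreal (\<pi> \<theta>) * indicator (ball \<theta>\<^sub>0 r) \<theta>"
        by (auto simp: indicator_def intro!: ennreal_leI)
    qed
    also have "\<dots> = emeasure (distr prior borel (\<lambda>\<theta>. \<theta>)) (ball \<theta>\<^sub>0 r)"
      using \<pi> unfolding d by (simp add: emeasure_density)
    also have "\<dots> = emeasure prior (ball \<theta>\<^sub>0 r)"
      using id sub by (simp add: emeasure_distr sp Int_absorb2)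
    finally show "ball \<theta>\<^sub>0 r \<subseteq> \<Theta> \<and> ball \<theta>\<^sub>0 r \<in> sets prior \<and>
       emeasure prior (ball \<theta>\<^sub>0 r) \<ge> ennreal (\<pi> \<theta>\<^sub>0 / 2 * v * r ^ CARD('d))"
      using sub B by blast
  qed (use v pos r1 r2 in auto)
qed

section \<open>Separation for convex losses\<close>

text \<open>
  A convex function bounded by \<open>C\<close> on a ball cannot drop far below its value at a point
  over a short distance: the value at \<open>s\<^sub>0\<close> is a convex combination of the one at a nearby
  point \<open>s\<close>, and of the one at a point \<open>v\<close> of the ball on the ray from \<open>s\<close> through \<open>s\<^sub>0\<close>.
\<close>

lemma convex_on_ball_ge:
  fixes f :: "'a :: real_normed_vector \<Rightarrow> real"
  assumes f: "convex_on \<Theta> f" "\<And>v. v \<in> \<Theta> \<Longrightarrow> 0 \<le> f v" and sub: "ball s\<^sub>0 \<gamma> \<subseteq> \<Theta>"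
    and C: "\<And>v. v \<in> ball s\<^sub>0 \<gamma> \<Longrightarrow> f v \<le> C" and a: "0 < a" "a < 1" and s: "dist s s\<^sub>0 < a * \<gamma> / 2"
  shows "f s\<^sub>0 - a * C \<le> f s"
proof -
  define v where "v = s + (1 / a) *\<^sub>R (s\<^sub>0 - s)"
  have \<gamma>: "\<gamma> > 0" using s a zero_le_dist[of s s\<^sub>0] by (smt (verit) divide_nonpos_pos mult_nonneg_nonpos)
  have "v - s\<^sub>0 = (1 / a - 1) *\<^sub>R (s\<^sub>0 - s)"
    by (simp add: v_def algebra_simps)
  then have "dist v s\<^sub>0 = (1 / a - 1) * dist s s\<^sub>0"
    using a by (simp add: dist_norm norm_minus_commute)
  also have "\<dots> \<le> 1 / a * dist s s\<^sub>0"
    by (intro mult_right_mono) auto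
  also have "\<dots> < \<gamma>"
  proof -
    have "dist s s\<^sub>0 < \<gamma> * a" using s mult_pos_pos[OF a(1) \<gamma>] by (simp add: mult.commute)
    then show ?thesis using a by (simp add: pos_divide_less_eq)
  qed
  finally have v: "v \<in> ball s\<^sub>0 \<gamma>" by (simp add: dist_commute)
  have "a * \<gamma> / 2 < \<gamma>" using a \<gamma> by (smt (verit) mult_less_cancel_right2 field_sum_of_halves)
  then have s': "s \<in> \<Theta>" using s sub by (auto simp: dist_commute subset_eq)
  have "(1 - a) *\<^sub>R s + a *\<^sub>R v = s\<^sub>0" using a by (simp add: v_def algebra_simps)
  then have "f s\<^sub>0 \<le> (1 - a) * f s + a * f v"
    using convex_onD[OF f(1), of a s v] a s' v sub by auto
  also have "\<dots> \<le> 1 * f s + a * C"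
    using a C[OF v] f(2)[OF s'] f(2)[of v] v sub by (intro add_mono mult_mono) auto
  finally show ?thesis by simp
qed

text \<open>Convergence at the finitely many vertices of a cube bounds \<open>f \<theta>\<close>
  above on the cube by convexity. With \<open>convex_on_ball_ge\<close> this yields a positive lower
  bound near each point of a small sphere, and compactness makes it uniform on the sphere. As
  \<open>f \<theta> x\<^sub>0\<close> tends to 0, convexity along rays carries the bound
  outwards.\<close>

lemma convex_pointwise_positive_imp_separated:
  fixes f :: "'t \<Rightarrow> 'a :: euclidean_space \<Rightarrow> real"
  assumes x\<^sub>0: "x\<^sub>0 \<in> interior \<Theta>" and \<Theta>: "convex \<Theta>"
    and convex: "\<forall>\<^sub>F \<theta> in F. convex_on \<Theta> (f \<theta>)" and nonneg: "\<forall>\<^sub>F \<theta> in F. \<forall>t\<in>\<Theta>. 0 \<le> f \<theta> t"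
    and lim: "\<And>t. t \<in> \<Theta> \<Longrightarrow> ((\<lambda>\<theta>. f \<theta> t) \<longlongrightarrow> g t) F"
    and g: "g x\<^sub>0 = 0" "\<And>t. t \<in> \<Theta> \<Longrightarrow> t \<noteq> x\<^sub>0 \<Longrightarrow> g t > 0" and B: "B > 0"
  shows "\<exists>\<kappa>>0. \<forall>\<^sub>F \<theta> in F. \<forall>t\<in>\<Theta>. dist t x\<^sub>0 > B \<longrightarrow> f \<theta> t \<ge> \<kappa>"
proof -
  obtain R where R: "R > 0" "cball x\<^sub>0 R \<subseteq> \<Theta>" using x\<^sub>0 by (auto simp: mem_interior_cball)
  \<comment> \<open>With this half side length, points of the cube are at l1-distance at most
    \<open>R\<close> from the centre, so the cube lies in \<open>cball x\<^sub>0 R\<close>.\<close>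
  define d where "d = R / DIM('a)"
  have d: "d > 0" using R by (simp add: d_def)
  let ?v = "\<Sum>i\<in>Basis. d *\<^sub>R i :: 'a"
  obtain V :: "'a set" where V: "finite V" "cbox (x\<^sub>0 - ?v) (x\<^sub>0 + ?v) = convex hull V"
    using cube_convex_hull[OF d] by blast
  have in_box: "x \<in> cbox (x\<^sub>0 - ?v) (x\<^sub>0 + ?v) \<longleftrightarrow> (\<forall>i\<in>Basis. \<bar>(x - x\<^sub>0) \<bullet> i\<bar> \<le> d)" for x
    by (auto simp: mem_box algebra_simps abs_le_iff)
  have "cbox (x\<^sub>0 - ?v) (x\<^sub>0 + ?v) \<subseteq> cball x\<^sub>0 R"
  proof
    fix x assume "x \<in> cbox (x\<^sub>0 - ?v) (x\<^sub>0 + ?v)"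
    then have "\<forall>i\<in>Basis. \<bar>(x - x\<^sub>0) \<bullet> i\<bar> \<le> d" unfolding in_box .
    then have "(\<Sum>i\<in>Basis. \<bar>(x - x\<^sub>0) \<bullet> i\<bar>) \<le> (\<Sum>i\<in>(Basis :: 'a set). d)"
      by (intro sum_mono) auto
    with norm_le_l1 have "norm (x - x\<^sub>0) \<le> (\<Sum>i\<in>(Basis :: 'a set). d)"
      by (rule order_trans)
    then show "x \<in> cball x\<^sub>0 R" using R by (simp add: d_def dist_norm norm_minus_commute)
  qed
  then have hull: "convex hull V \<subseteq> \<Theta>" using V(2) R(2) by auto
  then have V\<Theta>: "V \<subseteq> \<Theta>" using hull_subset[of V convex] by (rule subset_trans[rotated])
  have ball: "cball x\<^sub>0 d \<subseteq> convex hull V"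
    unfolding V(2)[symmetric]
  proof
    fix x assume "x \<in> cball x\<^sub>0 d"
    then show "x \<in> cbox (x\<^sub>0 - ?v) (x\<^sub>0 + ?v)"
      unfolding in_box using Basis_le_norm[of _ "x - x\<^sub>0"] by (force simp: dist_norm norm_minus_commute)
  qed
  \<comment> \<open>The terms are nonnegative, so the sum dominates each \<open>g v + 1\<close>. The
    last 1 makes \<open>C\<close> positive whatever \<open>V\<close> is.\<close>
  define C where "C = (\<Sum>v\<in>V. g v + 1) + 1"
  have gV: "0 \<le> g v" if "v \<in> \<Theta>" for v using g that by (cases "v = x\<^sub>0") (auto intro: less_imp_le)
  have C: "C > 0" unfolding C_def using gV V\<Theta> by (intro add_nonneg_pos sum_nonneg) (auto intro!: add_nonneg_nonneg)
  have "\<forall>\<^sub>F \<theta> in F. \<forall>v\<in>V. f \<theta> v < g v + 1"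
    using V(1) V\<Theta> by (intro eventually_ball_finite ballI order_tendstoD(2)[OF lim]) auto
  with convex have bound: "\<forall>\<^sub>F \<theta> in F. \<forall>t\<in>cball x\<^sub>0 d. f \<theta> t \<le> C"
  proof eventually_elim
    case (elim \<theta>)
    have "f \<theta> v \<le> C" if "v \<in> V" for v
    proof -
      have "g v + 1 \<le> (\<Sum>v\<in>V. g v + 1)"
        using V(1) V\<Theta> gV that by (intro member_le_sum) (auto intro!: add_nonneg_nonneg)
      then show ?thesis using elim that by (force simp: C_def)
    qed
    then have "\<forall>t\<in>convex hull V. f \<theta> t \<le> C"
      using elim(1) convex_on_subset[OF _ hull] convex_convex_hull by (intro convex_on_convex_hull_bound) blast+
    then show ?case using ball by blast
  qed
  \<comment> \<open>At most \<open>B\<close>, so that points beyond distance \<open>B\<close> lie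
    outside the sphere; at most \<open>d / 2\<close>, so that balls of radius \<open>d / 2\<close>
    around its points stay where the bound \<open>C\<close> holds.\<close>
  define \<epsilon> where "\<epsilon> = min B (d / 2)"
  have \<epsilon>: "\<epsilon> > 0" "\<epsilon> \<le> B" "\<epsilon> \<le> d / 2" using B d by (auto simp: \<epsilon>_def)
  have d\<Theta>: "cball x\<^sub>0 d \<subseteq> \<Theta>" using ball hull by blast
  have "\<exists>U \<kappa>. open U \<and> s \<in> U \<and> \<kappa> > 0 \<and> (\<forall>\<^sub>F \<theta> in F. \<forall>t\<in>U. f \<theta> t \<ge> \<kappa>)" if s: "s \<in> sphere x\<^sub>0 \<epsilon>" for s
  proof -
    have sub: "ball s (d / 2) \<subseteq> cball x\<^sub>0 d"
    proof
      fix x assume "x \<in> ball s (d / 2)"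
      then show "x \<in> cball x\<^sub>0 d" using s \<epsilon>(3) dist_triangle[of x\<^sub>0 x s] by auto
    qed
    have "s \<in> cball x\<^sub>0 d" using s \<epsilon> d by auto
    with d\<Theta> have s\<Theta>: "s \<in> \<Theta>" "s \<noteq> x\<^sub>0" using s \<epsilon>(1) by auto
    then have gs: "g s > 0" using g by blast
    \<comment> \<open>Near \<open>s\<close> the function falls by at most \<open>a * C\<close>,
      hence from above \<open>g s / 2\<close> to no less than \<open>g s / 4\<close>.\<close>
    define a where "a = min (1 / 2) (g s / (4 * C))"
    have a: "0 < a" "a < 1" "a * C \<le> g s / 4"
      using gs C by (auto simp: a_def min_def field_simps)
    have "\<forall>\<^sub>F \<theta> in F. f \<theta> s > g s / 2"
      using gs by (intro order_tendstoD(1)[OF lim[OF s\<Theta>(1)]]) auto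
    with convex nonneg bound have "\<forall>\<^sub>F \<theta> in F. \<forall>t\<in>ball s (a * (d / 2) / 2). f \<theta> t \<ge> g s / 4"
    proof eventually_elim
      case (elim \<theta>)
      show ?case
      proof
        fix t assume "t \<in> ball s (a * (d / 2) / 2)"
        then have "dist t s < a * (d / 2) / 2" by (simp add: dist_commute)
        moreover have "ball s (d / 2) \<subseteq> \<Theta>" "\<And>v. v \<in> ball s (d / 2) \<Longrightarrow> f \<theta> v \<le> C"
          using elim(3) sub d\<Theta> by blast+
        ultimately have "f \<theta> s - a * C \<le> f \<theta> t"
          using elim(1,2) a(1,2) by (intro convex_on_ball_ge[of \<Theta> "f \<theta>" s "d / 2"]) auto
        then show "f \<theta> t \<ge> g s / 4" using elim a by linarith
      qed
    qed
    moreover have "s \<in> ball s (a * (d / 2) / 2)" using a d by simp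
    ultimately show ?thesis using gs
      by (intro exI[of _ "ball s (a * (d / 2) / 2)"] exI[of _ "g s / 4"]) auto
  qed
  then obtain U \<kappa> where U: "\<And>s. s \<in> sphere x\<^sub>0 \<epsilon> \<Longrightarrow> open (U s) \<and> s \<in> U s \<and> \<kappa> s > 0 \<and> (\<forall>\<^sub>F \<theta> in F. \<forall>t\<in>U s. f \<theta> t \<ge> (\<kappa> s :: real))"
    by metis
  obtain D where D: "D \<subseteq> sphere x\<^sub>0 \<epsilon>" "finite D" "sphere x\<^sub>0 \<epsilon> \<subseteq> (\<Union>s\<in>D. U s)"
    by (rule compactE_image[of "sphere x\<^sub>0 \<epsilon>" "sphere x\<^sub>0 \<epsilon>" U]) (use U in auto)
  define k where "k = Min (insert 1 (\<kappa> ` D))"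
  have k: "k > 0" "\<And>s. s \<in> D \<Longrightarrow> k \<le> \<kappa> s" unfolding k_def using D U by (auto intro!: Min_le)
  have "\<forall>\<^sub>F \<theta> in F. \<forall>s\<in>D. \<forall>t\<in>U s. f \<theta> t \<ge> \<kappa> s"
    using D U by (intro eventually_ball_finite) auto
  moreover have "\<forall>\<^sub>F \<theta> in F. f \<theta> x\<^sub>0 < k"
    using k x\<^sub>0 g interior_subset by (intro order_tendstoD(2)[OF lim]) auto
  ultimately have "\<forall>\<^sub>F \<theta> in F. \<forall>t\<in>\<Theta>. dist t x\<^sub>0 > B \<longrightarrow> f \<theta> t \<ge> k"
    using convex
  proof eventually_elim
    case (elim \<theta>)
    show ?case
    proof (intro ballI impI)
      fix t assume t: "t \<in> \<Theta>" "dist t x\<^sub>0 > B"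
      define l where "l = \<epsilon> / dist t x\<^sub>0"
      have pos: "0 < dist t x\<^sub>0" using t B by linarith
      then have l: "0 < l" "l \<le> 1" using t \<epsilon> by (auto simp: l_def divide_le_eq_1 simp del: zero_less_dist_iff)
      \<comment> \<open>The segment from \<open>x\<^sub>0\<close> to \<open>t\<close> crosses the
        sphere at \<open>s\<close>. As the value is below \<open>k\<close> at
        \<open>x\<^sub>0\<close> and at least \<open>k\<close> at \<open>s\<close>, it is at least
        \<open>k\<close> at \<open>t\<close>.\<close>
      define s where "s = (1 - l) *\<^sub>R x\<^sub>0 + l *\<^sub>R t"
      have "s - x\<^sub>0 = l *\<^sub>R (t - x\<^sub>0)" by (simp add: s_def algebra_simps)
      then have "dist x\<^sub>0 s = l * dist t x\<^sub>0" using l by (simp add: dist_norm norm_minus_commute)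
      also have "\<dots> = \<epsilon>" using pos by (simp add: l_def)
      finally have "s \<in> sphere x\<^sub>0 \<epsilon>" by simp
      then obtain s' where "s' \<in> D" "s \<in> U s'" using D(3) by auto
      then have "k \<le> f \<theta> s" using elim(1) k(2) by force
      also have "f \<theta> s \<le> (1 - l) * f \<theta> x\<^sub>0 + l * f \<theta> t"
        unfolding s_def using elim(3) l t x\<^sub>0 interior_subset by (intro convex_onD) auto
      finally have "k \<le> (1 - l) * f \<theta> x\<^sub>0 + l * f \<theta> t" .
      moreover have "(1 - l) * f \<theta> x\<^sub>0 \<le> (1 - l) * k"
        using l elim(2) by (intro mult_left_mono) auto
      ultimately have "l * k \<le> l * f \<theta> t" by (simp add: algebra_simps)
      then show "k \<le> f \<theta> t" using l by simp
    qed
  qed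
  then show ?thesis using k by blast
qed

section \<open>Posterior concentration\<close>

text \<open>With \<open>\<sigma>\<close> the root of \<open>\<rho>\<close> of order
  \<open>Suc k\<close>, the expression with exponent \<open>Suc k\<close> is a power of
  \<open>real n * \<sigma> ^ n\<close>, which tends to 0. Using \<open>Suc k\<close> avoids a root
  of order 0.\<close>

lemma power_times_geometric_tendsto_0:
  fixes \<rho> :: real
  assumes "0 < \<rho>" "\<rho> < 1"
  shows "(\<lambda>n. real n ^ k * \<rho> ^ n) \<longlonglongrightarrow> 0"
proof -
  define \<sigma> where "\<sigma> = \<rho> powr (1 / Suc k)"
  have "\<rho> powr (1 / Suc k) < 1 powr (1 / Suc k)" using assms by (intro powr_less_mono2) auto
  then have \<sigma>: "0 < \<sigma>" "\<sigma> < 1" using assms by (auto simp: \<sigma>_def)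
  have \<rho>: "\<rho> = \<sigma> ^ Suc k"
    unfolding \<sigma>_def using assms by (subst powr_realpow[symmetric]) (auto simp: powr_powr)
  have "(\<lambda>n. (real n * \<sigma> ^ n) ^ Suc k) \<longlonglongrightarrow> 0 ^ Suc k"
    using powser_times_n_limit_0[of \<sigma>] \<sigma> by (intro tendsto_power) (auto simp: mult.commute)
  then have lim: "(\<lambda>n. real n ^ Suc k * \<rho> ^ n) \<longlonglongrightarrow> 0"
    unfolding \<rho> power_mult_distrib by (simp add: power_mult[symmetric] mult.commute del: power_Suc)
  show ?thesis
  proof (rule tendsto_sandwich[OF _ _ tendsto_const lim])
    show "\<forall>\<^sub>F n in sequentially. real n ^ k * \<rho> ^ n \<le> real n ^ Suc k * \<rho> ^ n"
      using eventually_ge_at_top[of 1]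
      by eventually_elim (use assms in \<open>auto intro!: mult_right_mono power_increasing\<close>)
  qed (use assms in auto)
qed

text \<open>
  An event \<open>A\<close> that is exponentially unlikely under the marginal law is unlikely under
  \<open>\<theta>\<^sub>0\<close>: on the ball of radius \<open>1/n\<^sup>2\<close> around \<open>\<theta>\<^sub>0\<close>, the law of the sample is within
  \<open>n * C/n\<^sup>2\<close> of the one under \<open>\<theta>\<^sub>0\<close>, and the prior mass of the ball is polynomial in \<open>1/n\<close>.
\<close>

lemma posterior_concentration:
  fixes \<Theta> :: "(real ^ 'd) set" and g :: "real ^ 'd \<Rightarrow> ennreal"
  assumes \<theta>\<^sub>0: "\<theta>\<^sub>0 \<in> \<Theta>" and model: "P \<in> param_space \<Theta> \<rightarrow>\<^sub>M prob_algebra M"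
    and prior: "prob_space prior" "sets prior = sets (param_space \<Theta>)"
    and post: "\<And>n. n \<ge> 1 \<Longrightarrow> is_posterior M P prior n (post n)"
    and tests: "uniformly_consistent_tests M \<Theta> P \<theta>\<^sub>0 \<epsilon> \<phi>"
    and tv: "C \<ge> 0" "r > 0"
    "\<And>\<theta> f. norm (\<theta> - \<theta>\<^sub>0) < r \<Longrightarrow> f \<in> borel_measurable M \<Longrightarrow> (\<And>x. f x \<le> 1) \<Longrightarrow>
       (\<integral>\<^sup>+x. f x \<partial>P \<theta>\<^sub>0) \<le> (\<integral>\<^sup>+x. f x \<partial>P \<theta>) + ennreal (C * norm (\<theta> - \<theta>\<^sub>0))"
    and mass: "c > 0" "r\<^sub>0 > 0"
    "\<And>r. 0 < r \<Longrightarrow> r \<le> r\<^sub>0 \<Longrightarrow> ball \<theta>\<^sub>0 r \<subseteq> \<Theta> \<and> ball \<theta>\<^sub>0 r \<in> sets prior \<and>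
       emeasure prior (ball \<theta>\<^sub>0 r) \<ge> ennreal (c * r ^ d)"
    and g: "g \<in> borel_measurable prior" "(\<integral>\<^sup>+\<theta>. g \<theta> \<partial>prior) < \<infinity>" and \<eta>: "\<eta> > 0"
  shows "(\<lambda>n. measure (iid_law (P \<theta>\<^sub>0) n) {x \<in> space (sample_space M n).
            ennreal \<eta> \<le> (\<integral>\<^sup>+\<theta>\<in>{\<theta>\<in>\<Theta>. norm (\<theta> - \<theta>\<^sub>0) \<ge> \<epsilon>}. g \<theta> \<partial>post n x)}) \<longlonglongrightarrow> 0"
proof -
  let ?m = "marginal_law M P prior"
  let ?S = "sample_space M"
  let ?F = "{\<theta>\<in>\<Theta>. norm (\<theta> - \<theta>\<^sub>0) \<ge> \<epsilon>}"
  interpret prior: prob_space prior by fact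
  have sp: "space prior = \<Theta>" using sets_eq_imp_space_eq[OF prior(2)] by (simp add: space_restrict_space)
  have P_meas: "P \<in> prior \<rightarrow>\<^sub>M prob_algebra M"
    unfolding measurable_cong_sets[OF prior(2) refl] by (rule model)
  have P: "prob_space (P \<theta>)" "sets (P \<theta>) = sets M" if "\<theta> \<in> \<Theta>" for \<theta>
    using measurable_space[OF model, of \<theta>] that by (auto simp: space_prob_algebra space_restrict_space)
  have sP: "sets (iid_law (P \<theta>) n) = sets (?S n)" if "\<theta> \<in> \<Theta>" for \<theta> n
    using P[OF that] by (intro sets_PiM_cong) auto
  have prob: "prob_space (iid_law (P \<theta>) n)" if "\<theta> \<in> \<Theta>" for \<theta> n
    using P that by (intro prob_space_PiM)
  have F: "?F \<in> sets prior"
  proof -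
    have "?F = \<Theta> \<inter> {\<theta>. norm (\<theta> - \<theta>\<^sub>0) \<ge> \<epsilon>}" by auto
    moreover have "{\<theta>. norm (\<theta> - \<theta>\<^sub>0) \<ge> \<epsilon>} \<in> sets borel" by measurable
    ultimately show ?thesis unfolding prior(2) sets_restrict_space by blast
  qed
  obtain D \<rho> W where D: "D \<ge> 0" and \<rho>: "0 < \<rho>" "\<rho> < 1" and W: "\<And>n. W n \<in> sets (?S n)"
    and W0: "\<And>n. emeasure (iid_law (P \<theta>\<^sub>0) n) (space (?S n) - W n) \<le> ennreal (D * \<rho> ^ n)"
    and WF: "\<And>n \<theta>. \<theta> \<in> \<Theta> \<Longrightarrow> norm (\<theta> - \<theta>\<^sub>0) \<ge> \<epsilon> \<Longrightarrow> emeasure (iid_law (P \<theta>) n) (W n) \<le> ennreal (D * \<rho> ^ n)"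
    using exponential_tests[OF model \<theta>\<^sub>0 tests] by metis
  define I where "I = enn2real (\<integral>\<^sup>+\<theta>. g \<theta> \<partial>prior)"
  have I: "I \<ge> 0" "(\<integral>\<^sup>+\<theta>. g \<theta> \<partial>prior) = ennreal I" using g(2) by (auto simp: I_def less_top)
  define G where "G n x = (\<integral>\<^sup>+\<theta>\<in>?F. g \<theta> \<partial>post n x)" for n x
  define E where "E n = {x \<in> space (?S n). ennreal \<eta> \<le> G n x}" for n
  have E: "E n \<in> sets (?S n)" if "n \<ge> 1" for n
  proof -
    have "post n \<in> ?S n \<rightarrow>\<^sub>M subprob_algebra prior"
      using post[OF that] by (auto simp: is_posterior_def dest: measurable_prob_algebraD)
    then have "G n \<in> borel_measurable (?S n)"
      unfolding G_def using nn_integral_measurable_subprob_algebra2[of "\<lambda>_ \<theta>. g \<theta> * indicator ?F \<theta>"] g(1) F by simp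
    then show ?thesis unfolding E_def by (intro borel_measurable_le) auto
  qed
  \<comment> \<open>Markov's inequality for the posterior integral, followed by the exchange to the
    prior: there only parameters in \<open>?F\<close> contribute, and for these \<open>W n\<close>
    is exponentially unlikely.\<close>
  have marginal: "emeasure (?m n) (E n \<inter> W n) \<le> ennreal (D * I / \<eta> * \<rho> ^ n)" if n: "n \<ge> 1" for n
  proof -
    have A: "E n \<inter> W n \<in> sets (?S n)" using E[OF n] W by blast
    then have A': "E n \<inter> W n \<in> sets (?m n)" by (simp add: marginal_law_def)
    have "ennreal \<eta> * emeasure (?m n) (E n \<inter> W n) = (\<integral>\<^sup>+x. ennreal \<eta> * indicator (E n \<inter> W n) x \<partial>?m n)"
      using A' by (simp add: nn_integral_cmult_indicator)
    also have "\<dots> \<le> (\<integral>\<^sup>+x\<in>E n \<inter> W n. (\<integral>\<^sup>+\<theta>. g \<theta> * indicator ?F \<theta> \<partial>post n x) \<partial>?m n)"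
      by (intro nn_integral_mono) (auto simp: indicator_def E_def G_def)
    also have "\<dots> = (\<integral>\<^sup>+\<theta>. g \<theta> * indicator ?F \<theta> * emeasure (iid_law (P \<theta>) n) (E n \<inter> W n) \<partial>prior)"
      using P_meas prior(1) post[OF n] A g(1) F by (intro posterior_nn_integral) auto
    also have "\<dots> \<le> (\<integral>\<^sup>+\<theta>. g \<theta> * ennreal (D * \<rho> ^ n) \<partial>prior)"
    proof (rule nn_integral_mono)
      fix \<theta>
      have "emeasure (iid_law (P \<theta>) n) (E n \<inter> W n) \<le> ennreal (D * \<rho> ^ n)" if "\<theta> \<in> ?F"
      proof -
        have "emeasure (iid_law (P \<theta>) n) (E n \<inter> W n) \<le> emeasure (iid_law (P \<theta>) n) (W n)"
          using that W[of n] sP[of \<theta> n] by (intro emeasure_mono) auto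
        also have "\<dots> \<le> ennreal (D * \<rho> ^ n)" using that by (intro WF) auto
        finally show ?thesis .
      qed
      then show "g \<theta> * indicator ?F \<theta> * emeasure (iid_law (P \<theta>) n) (E n \<inter> W n) \<le> g \<theta> * ennreal (D * \<rho> ^ n)"
        by (auto simp: indicator_def intro!: mult_left_mono)
    qed
    also have "\<dots> = ennreal (I * (D * \<rho> ^ n))"
      using g(1) D \<rho> I by (simp add: nn_integral_multc ennreal_mult)
    finally have "ennreal (1 / \<eta>) * (ennreal \<eta> * emeasure (?m n) (E n \<inter> W n)) \<le> ennreal (1 / \<eta>) * ennreal (I * (D * \<rho> ^ n))"
      by (rule mult_left_mono) simp
    then show ?thesis
      using \<eta> D \<rho> I by (simp add: mult.assoc[symmetric] ennreal_mult[symmetric]) (simp add: mult_ac)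
  qed
  have true_law: "measure (iid_law (P \<theta>\<^sub>0) n) (E n \<inter> W n) \<le>
      C / n + D * I / (\<eta> * c) * (real n ^ (2 * d) * \<rho> ^ n)"
    if n: "n \<ge> 1" "1 / (real n)\<^sup>2 < r" "1 / (real n)\<^sup>2 < r\<^sub>0" for n
  proof -
    interpret P0: prob_space "iid_law (P \<theta>\<^sub>0) n" using \<theta>\<^sub>0 by (rule prob)
    \<comment> \<open>This radius makes the total variation error \<open>n * C * s = C / n\<close>
      vanish while the prior mass of the ball, at least \<open>c * s ^ d\<close>, decays only
      polynomially.\<close>
    define s where "s = 1 / (real n)\<^sup>2"
    have s: "0 < s" "s < r" "s < r\<^sub>0" using n by (auto simp: s_def)
    define B where "B = ball \<theta>\<^sub>0 s"
    have B: "B \<subseteq> \<Theta>" "B \<in> sets prior" "ennreal (c * s ^ d) \<le> emeasure prior B"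
      using mass(3)[of s] s by (auto simp: B_def)
    define \<beta> where "\<beta> = measure prior B"
    have \<beta>: "emeasure prior B = ennreal \<beta>" "c * s ^ d \<le> \<beta>"
      using B(3) unfolding \<beta>_def by (auto simp: prior.emeasure_eq_measure)
    have cs: "0 < c * s ^ d" using s mass by simp
    have A: "E n \<inter> W n \<in> sets (?S n)" using E[OF n(1)] W by blast
    have le: "emeasure (iid_law (P \<theta>\<^sub>0) n) (E n \<inter> W n) \<le> emeasure (iid_law (P \<theta>) n) (E n \<inter> W n) + ennreal (C / n)"
      if "\<theta> \<in> B" for \<theta>
    proof -
      have \<theta>: "\<theta> \<in> \<Theta>" "norm (\<theta> - \<theta>\<^sub>0) < s"
        using that B(1) by (auto simp: B_def dist_norm norm_minus_commute)
      have ind_le: "indicator (E n \<inter> W n) x \<le> (1 :: ennreal)" for x by (simp add: indicator_def)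
      have "(\<integral>\<^sup>+x. indicator (E n \<inter> W n) x \<partial>iid_law (P \<theta>\<^sub>0) n) \<le>
          (\<integral>\<^sup>+x. indicator (E n \<inter> W n) x \<partial>iid_law (P \<theta>) n) + of_nat n * ennreal (C * norm (\<theta> - \<theta>\<^sub>0))"
        using P[OF \<theta>\<^sub>0] P[OF \<theta>(1)] A \<theta>(2) s(2)
        by (intro nn_integral_iid_law_le[where M=M] tv(3) borel_measurable_indicator ind_le) auto
      also have "of_nat n * ennreal (C * norm (\<theta> - \<theta>\<^sub>0)) = ennreal (n * (C * norm (\<theta> - \<theta>\<^sub>0)))"
        using tv(1) by (simp add: ennreal_mult ennreal_of_nat_eq_real_of_nat)
      also have "\<dots> \<le> ennreal (n * (C * s))"
        using \<theta>(2) tv(1) by (intro ennreal_leI mult_left_mono) auto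
      also have "n * (C * s) = C / n" using n(1) by (simp add: s_def power2_eq_square)
      finally show ?thesis using A sP[OF \<theta>\<^sub>0, of n] sP[OF \<theta>(1), of n] by (simp add: add_left_mono)
    qed
    have meas: "(\<lambda>\<theta>. emeasure (iid_law (P \<theta>) n) (E n \<inter> W n)) \<in> borel_measurable prior"
      using measurable_prob_algebraD[OF measurable_iid_law[OF P_meas]] A by (rule measurable_emeasure_kernel) simp
    have "emeasure (iid_law (P \<theta>\<^sub>0) n) (E n \<inter> W n) * emeasure prior B
        = (\<integral>\<^sup>+\<theta>\<in>B. emeasure (iid_law (P \<theta>\<^sub>0) n) (E n \<inter> W n) \<partial>prior)"
      using B(2) by (simp add: nn_integral_cmult_indicator)
    \<comment> \<open>The comparison is averaged over the ball. Extending the first summand to all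
      parameters only increases it and produces the marginal law.\<close>
    also have "\<dots> \<le> (\<integral>\<^sup>+\<theta>. emeasure (iid_law (P \<theta>) n) (E n \<inter> W n) + ennreal (C / n) * indicator B \<theta> \<partial>prior)"
      using le by (intro nn_integral_mono) (auto simp: indicator_def)
    also have "\<dots> = emeasure (?m n) (E n \<inter> W n) + ennreal (C / n) * emeasure prior B"
      using meas B(2) by (simp add: nn_integral_add nn_integral_cmult_indicator emeasure_marginal_law[OF P_meas prior(1) A])
    also have "\<dots> \<le> ennreal (D * I / \<eta> * \<rho> ^ n) + ennreal (C / n) * emeasure prior B"
      using marginal[OF n(1)] by (rule add_right_mono)
    finally have "ennreal (measure (iid_law (P \<theta>\<^sub>0) n) (E n \<inter> W n) * \<beta>) \<le> ennreal (D * I / \<eta> * \<rho> ^ n + C / n * \<beta>)"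
      using \<eta> D \<rho> I tv(1) unfolding \<beta>(1) P0.emeasure_eq_measure \<beta>_def
      by (simp add: ennreal_mult[symmetric] ennreal_plus[symmetric] del: ennreal_plus)
    then have "measure (iid_law (P \<theta>\<^sub>0) n) (E n \<inter> W n) * \<beta> \<le> D * I / \<eta> * \<rho> ^ n + C / n * \<beta>"
      using \<eta> D \<rho> I tv(1) by (subst (asm) ennreal_le_iff) (auto simp: \<beta>_def)
    moreover have "0 < \<beta>" using cs \<beta>(2) by linarith
    ultimately have "measure (iid_law (P \<theta>\<^sub>0) n) (E n \<inter> W n) \<le> (D * I / \<eta> * \<rho> ^ n + C / n * \<beta>) / \<beta>"
      by (simp add: pos_le_divide_eq)
    also have "\<dots> = C / n + (D * I / \<eta> * \<rho> ^ n) / \<beta>"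
      using \<open>0 < \<beta>\<close> by (simp add: add_divide_distrib)
    also have "(D * I / \<eta> * \<rho> ^ n) / \<beta> \<le> (D * I / \<eta> * \<rho> ^ n) / (c * s ^ d)"
      using \<eta> D \<rho> I cs \<beta>(2) by (intro divide_left_mono) auto
    also have "\<dots> = D * I / (\<eta> * c) * (real n ^ (2 * d) * \<rho> ^ n)"
    proof -
      have "c * s ^ d = c / real n ^ (2 * d)" by (simp add: s_def power_divide power_mult)
      then show ?thesis by simp
    qed
    finally show ?thesis by simp
  qed
  have "measure (iid_law (P \<theta>\<^sub>0) n) (E n) \<le> C / n + D * I / (\<eta> * c) * (real n ^ (2 * d) * \<rho> ^ n) + D * \<rho> ^ n"
    if n: "n \<ge> 1" "1 / (real n)\<^sup>2 < r" "1 / (real n)\<^sup>2 < r\<^sub>0" for n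
  proof -
    interpret P0: prob_space "iid_law (P \<theta>\<^sub>0) n" using \<theta>\<^sub>0 by (rule prob)
    have W': "space (?S n) - W n \<in> sets (?S n)" using W by blast
    \<comment> \<open>Outside \<open>W n\<close> nothing is known about the posterior, but this part
      is exponentially unlikely under \<open>\<theta>\<^sub>0\<close>.\<close>
    have "measure (iid_law (P \<theta>\<^sub>0) n) (E n) \<le> measure (iid_law (P \<theta>\<^sub>0) n) ((E n \<inter> W n) \<union> (space (?S n) - W n))"
      using E[OF n(1)] W[of n] W' sP[OF \<theta>\<^sub>0, of n] by (intro P0.finite_measure_mono) (auto simp: E_def)
    also have "\<dots> \<le> measure (iid_law (P \<theta>\<^sub>0) n) (E n \<inter> W n) + measure (iid_law (P \<theta>\<^sub>0) n) (space (?S n) - W n)"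
      using E[OF n(1)] W[of n] W' sP[OF \<theta>\<^sub>0, of n] by (intro measure_Un_le) auto
    also have "measure (iid_law (P \<theta>\<^sub>0) n) (space (?S n) - W n) \<le> D * \<rho> ^ n"
      using W0[of n] D \<rho> by (simp add: P0.emeasure_eq_measure)
    finally show ?thesis using true_law[OF n] by simp
  qed
  moreover have "\<forall>\<^sub>F n in sequentially. n \<ge> 1 \<and> 1 / (real n)\<^sup>2 < r \<and> 1 / (real n)\<^sup>2 < r\<^sub>0"
  proof -
    have "(\<lambda>n. 1 / (real n)\<^sup>2) \<longlonglongrightarrow> 0"
      using tendsto_power[OF lim_1_over_n[where 'a=real], of 2] by (simp add: power_divide)
    then show ?thesis
      using tv(2) mass(2) by (intro eventually_conj eventually_ge_at_top order_tendstoD(2)) auto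
  qed
  ultimately have ev: "\<forall>\<^sub>F n in sequentially. measure (iid_law (P \<theta>\<^sub>0) n) (E n) \<le>
      C / n + D * I / (\<eta> * c) * (real n ^ (2 * d) * \<rho> ^ n) + D * \<rho> ^ n"
    by (auto elim: eventually_mono)
  have "(\<lambda>n. C / n + D * I / (\<eta> * c) * (real n ^ (2 * d) * \<rho> ^ n) + D * \<rho> ^ n) \<longlonglongrightarrow>
      0 + D * I / (\<eta> * c) * 0 + D * 0"
    using \<rho> by (intro tendsto_intros lim_const_over_n power_times_geometric_tendsto_0 LIMSEQ_power_zero) auto
  then have "(\<lambda>n. measure (iid_law (P \<theta>\<^sub>0) n) (E n)) \<longlonglongrightarrow> 0"
    by (intro tendsto_sandwich[OF _ ev tendsto_const]) auto
  then show ?thesis by (simp add: E_def G_def)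
qed

section \<open>Consistency of Bayes estimators\<close>

theorem proposition2:
  fixes M \<mu> :: "'x measure"
    and \<Theta> :: "(real ^ 'd) set"
    and P :: "real ^ 'd \<Rightarrow> 'x measure"
    and prior :: "(real ^ 'd) measure"
    and \<theta>\<^sub>0 :: "real ^ 'd"
    and score :: "'x \<Rightarrow> real ^ 'd"
    and \<pi> :: "real ^ 'd \<Rightarrow> real"
    and post :: "nat \<Rightarrow> (nat \<Rightarrow> 'x) \<Rightarrow> (real ^ 'd) measure"
    and loss :: "real ^ 'd \<Rightarrow> real ^ 'd \<Rightarrow> real"
    and c\<^sub>1 c\<^sub>2 c\<^sub>3 :: real
    and est :: "nat \<Rightarrow> (nat \<Rightarrow> 'x) \<Rightarrow> real ^ 'd"
  assumes theta0: "\<theta>\<^sub>0 \<in> interior \<Theta>"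
    and dominating: "sigma_finite_measure \<mu>" "sets \<mu> = sets M"
    and model: "P \<in> param_space \<Theta> \<rightarrow>\<^sub>M prob_algebra M"
    and dominated: "\<And>\<theta>. \<theta> \<in> \<Theta> \<Longrightarrow> absolutely_continuous \<mu> (P \<theta>)"
    and prior_measure: "prob_space prior" "sets prior = sets (param_space \<Theta>)"
    and posterior: "\<And>n. n \<ge> 1 \<Longrightarrow> is_posterior M P prior n (post n)"
    and marginal_dominates:
      "\<And>n. n \<ge> 1 \<Longrightarrow> absolutely_continuous (marginal_law M P prior n) (iid_law (P \<theta>\<^sub>0) n)"
    and dqm: "dqm_at \<mu> P \<theta>\<^sub>0 score"
    and fisher: "invertible (fisher_information (P \<theta>\<^sub>0) score)"
    and tests: "\<And>\<epsilon>. \<epsilon> > 0 \<Longrightarrow> \<exists>\<phi>. uniformly_consistent_tests M \<Theta> P \<theta>\<^sub>0 \<epsilon> \<phi>"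
    and prior_density:
      "\<pi> \<in> borel_measurable borel" "\<And>\<theta>. \<pi> \<theta> \<ge> 0"
      "distr prior borel (\<lambda>\<theta>. \<theta>) = density lborel (\<lambda>\<theta>. ennreal (\<pi> \<theta>))"
      "\<exists>U. open U \<and> \<theta>\<^sub>0 \<in> U \<and> continuous_on U \<pi>"
      "\<pi> \<theta>\<^sub>0 > 0"
    and loss: "loss_function \<Theta> loss"
    and loss_prior_finite: "\<And>t. t \<in> \<Theta> \<Longrightarrow> expected_loss loss prior t < \<infinity>"
    and loss_growth:
      "c\<^sub>1 > 0" "c\<^sub>2 > 0" "0 < c\<^sub>3" "c\<^sub>3 < 2"
      "\<And>t \<theta>. t \<in> \<Theta> \<Longrightarrow> \<theta> \<in> \<Theta> \<Longrightarrow>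
         loss t \<theta> \<le> c\<^sub>1 * exp (c\<^sub>2 * norm t powr c\<^sub>3 + c\<^sub>2 * norm \<theta> powr c\<^sub>3)"
    and loss_continuous:
      "\<And>t. t \<in> \<Theta> \<Longrightarrow> continuous (at \<theta>\<^sub>0 within \<Theta>) (\<lambda>\<theta>. loss t \<theta>)"
    and separation_or_convexity:
      "(\<forall>B>0. \<exists>\<delta>>0.
          (INF (t, \<theta>)\<in>{(t, \<theta>). t \<in> \<Theta> \<and> \<theta> \<in> \<Theta> \<and> norm (t - \<theta>\<^sub>0) > B \<and> norm (\<theta> - \<theta>\<^sub>0) \<le> \<delta>}.
             ennreal (loss t \<theta>)) > 0)
       \<or> (convex \<Theta> \<and> (\<forall>\<theta>\<in>\<Theta>. convex_on \<Theta> (\<lambda>t. loss t \<theta>)))"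
    and bayes: "\<And>n. n \<ge> 1 \<Longrightarrow> is_bayes_estimator M \<Theta> P prior loss n (post n) (est n)"
  shows "consistent_at est (P \<theta>\<^sub>0) \<theta>\<^sub>0"
proof -
  have \<theta>\<^sub>0: "\<theta>\<^sub>0 \<in> \<Theta>" using theta0 interior_subset by auto
  have P: "prob_space (P \<theta>)" "sets (P \<theta>) = sets M" if "\<theta> \<in> \<Theta>" for \<theta>
    using measurable_space[OF model, of \<theta>] that by (auto simp: space_prob_algebra space_restrict_space)
  have sP: "sets (iid_law (P \<theta>\<^sub>0) n) = sets (sample_space M n)" for n
    using P[OF \<theta>\<^sub>0] by (intro sets_PiM_cong) auto
  note spP = sets_eq_imp_space_eq[OF sP]
  have space_prior: "space prior = \<Theta>"
    using sets_eq_imp_space_eq[OF prior_measure(2)] by (simp add: space_restrict_space)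
  interpret prior: prob_space prior by fact
  have loss_meas: "(\<lambda>\<theta>. loss t \<theta>) \<in> borel_measurable prior" if "t \<in> \<Theta>" for t
  proof -
    have f: "case_prod loss \<in> borel_measurable (param_space \<Theta> \<Otimes>\<^sub>M param_space \<Theta>)"
      using loss by (simp add: loss_function_def)
    have t: "t \<in> space (param_space \<Theta>)" using that by (simp add: space_restrict_space)
    show ?thesis
      using measurable_Pair2[OF f t] unfolding measurable_cong_sets[OF prior_measure(2) refl] by simp
  qed
  have loss_nonneg: "0 \<le> loss t \<theta>" if "t \<in> \<Theta>" "\<theta> \<in> \<Theta>" for t \<theta>
    using loss that by (auto simp: loss_function_def)
  have loss_eq_0: "loss t \<theta> = 0 \<longleftrightarrow> t = \<theta>" if "t \<in> \<Theta>" "\<theta> \<in> \<Theta>" for t \<theta>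
    using loss that by (auto simp: loss_function_def)
  \<comment> \<open>Unlike the punctured filter of continuity, this filter includes
    \<open>\<theta>\<^sub>0\<close> itself; the limit being the value there, convergence
    persists.\<close>
  have loss_tendsto: "((\<lambda>\<theta>. loss t \<theta>) \<longlongrightarrow> loss t \<theta>\<^sub>0) (inf (nhds \<theta>\<^sub>0) (principal \<Theta>))" if "t \<in> \<Theta>" for t
    using loss_continuous[OF that] by (simp add: continuous_within tendsto_at_within_iff_tendsto_nhds)
  \<comment> \<open>Both alternatives of the hypothesis are brought to this common form with a real
    bound \<open>\<kappa>\<close>.\<close>
  have separation: "\<exists>\<kappa>>0. \<exists>\<delta>>0. \<forall>t\<in>\<Theta>. \<forall>\<theta>\<in>\<Theta>. norm (t - \<theta>\<^sub>0) > B \<longrightarrow> norm (\<theta> - \<theta>\<^sub>0) < \<delta> \<longrightarrow> loss t \<theta> \<ge> \<kappa>"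
    if B: "B > 0" for B :: real
    using separation_or_convexity
  proof (elim disjE conjE)
    assume "\<forall>B>0. \<exists>\<delta>>0.
          (INF (t, \<theta>)\<in>{(t, \<theta>). t \<in> \<Theta> \<and> \<theta> \<in> \<Theta> \<and> norm (t - \<theta>\<^sub>0) > B \<and> norm (\<theta> - \<theta>\<^sub>0) \<le> \<delta>}.
             ennreal (loss t \<theta>)) > 0" (is "\<forall>B>0. \<exists>\<delta>>0. 0 < ?I B \<delta>")
    from this[THEN spec, THEN mp, OF B] obtain \<delta> where \<delta>: "\<delta> > 0" "0 < ?I B \<delta>" by (elim exE conjE)
    \<comment> \<open>The infimum is infinite if no pair qualifies, so a finite value strictly below
      it is chosen.\<close>
    from dense[OF \<delta>(2)] obtain k where k: "0 < k" "k < ?I B \<delta>" by (elim exE conjE)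
    have "k < \<top>" using k(2) top_greatest by (rule less_le_trans)
    with k(1) have \<kappa>: "k = ennreal (enn2real k)" "0 < enn2real k" by (auto simp: enn2real_positive_iff)
    show ?thesis
    proof (intro exI conjI ballI impI)
      fix t \<theta> assume t: "t \<in> \<Theta>" "\<theta> \<in> \<Theta>" "norm (t - \<theta>\<^sub>0) > B" "norm (\<theta> - \<theta>\<^sub>0) < \<delta>"
      then have "?I B \<delta> \<le> (case (t, \<theta>) of (t, \<theta>) \<Rightarrow> ennreal (loss t \<theta>))"
        by (intro INF_lower) auto
      with k(2) have "k \<le> ennreal (loss t \<theta>)" by simp
      then show "enn2real k \<le> loss t \<theta>"
        using loss_nonneg[OF t(1,2)] by (subst (asm) \<kappa>(1)) (simp add: ennreal_le_iff)
    qed (rule \<kappa>(2) \<delta>(1))+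
  next
    assume convex: "convex \<Theta>" "\<forall>\<theta>\<in>\<Theta>. convex_on \<Theta> (\<lambda>t. loss t \<theta>)"
    \<comment> \<open>The convex functions are \<open>t \<mapsto> loss t \<theta>\<close>, indexed
      by \<open>\<theta>\<close> tending to \<open>\<theta>\<^sub>0\<close> within
      \<open>\<Theta>\<close>. Their pointwise limit \<open>loss t \<theta>\<^sub>0\<close> vanishes
      only at \<open>t = \<theta>\<^sub>0\<close>.\<close>
    have "\<exists>\<kappa>>0. \<forall>\<^sub>F \<theta> in inf (nhds \<theta>\<^sub>0) (principal \<Theta>). \<forall>t\<in>\<Theta>. dist t \<theta>\<^sub>0 > B \<longrightarrow> loss t \<theta> \<ge> \<kappa>"
    proof (rule convex_pointwise_positive_imp_separated[where g="\<lambda>t. loss t \<theta>\<^sub>0"])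
      show "loss t \<theta>\<^sub>0 > 0" if "t \<in> \<Theta>" "t \<noteq> \<theta>\<^sub>0" for t
        using loss_nonneg[OF that(1) \<theta>\<^sub>0] loss_eq_0[OF that(1) \<theta>\<^sub>0] that(2) by simp
    qed (use theta0 convex loss_nonneg loss_tendsto loss_eq_0[OF \<theta>\<^sub>0 \<theta>\<^sub>0] B in \<open>auto simp: eventually_inf_principal\<close>)
    then show ?thesis
      by (fastforce simp: eventually_inf_principal eventually_nhds_metric dist_norm)
  qed
  obtain C r where tv: "C \<ge> 0" "r > 0"
    "\<And>\<theta> f. norm (\<theta> - \<theta>\<^sub>0) < r \<Longrightarrow> f \<in> borel_measurable \<mu> \<Longrightarrow> (\<And>x. f x \<le> 1) \<Longrightarrow>
       (\<integral>\<^sup>+x. f x \<partial>P \<theta>\<^sub>0) \<le> (\<integral>\<^sup>+x. f x \<partial>P \<theta>) + ennreal (C * norm (\<theta> - \<theta>\<^sub>0))"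
    using dqm_at_imp_nn_integral_le[OF theta0 dominating(1) P(1) _ dominated dqm] P(2) dominating(2) by metis
  obtain U where U: "open U" "\<theta>\<^sub>0 \<in> U" "continuous_on U \<pi>" using prior_density(4) by blast
  obtain c r\<^sub>0 where mass: "c > 0" "r\<^sub>0 > 0"
    "\<And>r. 0 < r \<Longrightarrow> r \<le> r\<^sub>0 \<Longrightarrow> ball \<theta>\<^sub>0 r \<subseteq> \<Theta> \<and> ball \<theta>\<^sub>0 r \<in> sets prior \<and>
       emeasure prior (ball \<theta>\<^sub>0 r) \<ge> ennreal (c * r ^ CARD('d))"
    using emeasure_ball_density_ge[OF theta0 prior_measure(2) prior_density(3,1,2) U prior_density(5)] by metis
  show ?thesis
    unfolding consistent_at_def
  proof (intro allI impI)
    fix B :: real assume B: "B > 0"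
    obtain \<kappa> \<delta>1 where \<kappa>: "\<kappa> > 0" and \<delta>1: "\<delta>1 > 0"
      "\<And>t \<theta>. t \<in> \<Theta> \<Longrightarrow> \<theta> \<in> \<Theta> \<Longrightarrow> norm (t - \<theta>\<^sub>0) > B \<Longrightarrow> norm (\<theta> - \<theta>\<^sub>0) < \<delta>1 \<Longrightarrow> loss t \<theta> \<ge> \<kappa>"
      using separation[OF B] by blast
    have "\<forall>\<^sub>F \<theta> in inf (nhds \<theta>\<^sub>0) (principal \<Theta>). loss \<theta>\<^sub>0 \<theta> < \<kappa> / 4"
      using \<kappa> loss_eq_0[OF \<theta>\<^sub>0 \<theta>\<^sub>0] by (intro order_tendstoD(2)[OF loss_tendsto[OF \<theta>\<^sub>0]]) auto
    then obtain \<delta>2 where \<delta>2: "\<delta>2 > 0" "\<And>\<theta>. \<theta> \<in> \<Theta> \<Longrightarrow> norm (\<theta> - \<theta>\<^sub>0) < \<delta>2 \<Longrightarrow> loss \<theta>\<^sub>0 \<theta> < \<kappa> / 4"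
      by (auto simp: eventually_inf_principal eventually_nhds_metric dist_norm)
    define \<delta> where "\<delta> = min \<delta>1 \<delta>2"
    have \<delta>: "\<delta> > 0" using \<delta>1 \<delta>2 by (simp add: \<delta>_def)
    obtain \<phi> where \<phi>: "uniformly_consistent_tests M \<Theta> P \<theta>\<^sub>0 \<delta> \<phi>" using tests[OF \<delta>] by blast
    define F where "F = {\<theta>\<in>\<Theta>. norm (\<theta> - \<theta>\<^sub>0) \<ge> \<delta>}"
    define N where "N = \<Theta> - F"
    have F: "F \<in> sets prior"
    proof -
      have "F = \<Theta> \<inter> {\<theta>. norm (\<theta> - \<theta>\<^sub>0) \<ge> \<delta>}" by (auto simp: F_def)
      moreover have "{\<theta>. norm (\<theta> - \<theta>\<^sub>0) \<ge> \<delta>} \<in> sets borel" by measurable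
      ultimately show ?thesis unfolding prior_measure(2) sets_restrict_space by blast
    qed
    then have N: "N \<in> sets prior" unfolding N_def using space_prior by (metis sets.compl_sets)
    \<comment> \<open>A bound on the integral of \<open>g\<close> over \<open>F\<close> controls two
      quantities at once: the summand 1 gives the posterior mass of \<open>F\<close>, the loss its
      share of the expected loss of \<open>\<theta>\<^sub>0\<close>.\<close>
    define g where "g \<theta> = ennreal (loss \<theta>\<^sub>0 \<theta>) + 1" for \<theta>
    have g: "g \<in> borel_measurable prior"
      unfolding g_def[abs_def] using loss_meas[OF \<theta>\<^sub>0] by measurable
    have g_finite: "(\<integral>\<^sup>+\<theta>. g \<theta> \<partial>prior) < \<infinity>"
      unfolding g_def using loss_meas[OF \<theta>\<^sub>0] loss_prior_finite[OF \<theta>\<^sub>0]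
      by (subst nn_integral_add) (auto simp: expected_loss_def prior.emeasure_space_1)
    \<comment> \<open>The bound 1/2 leaves the neighbourhood \<open>N\<close> at least half the
      posterior mass. The bound \<open>\<kappa> / 4\<close>, added to the loss of less than
      \<open>\<kappa> / 4\<close> on \<open>N\<close>, keeps the expected loss of
      \<open>\<theta>\<^sub>0\<close> below \<open>\<kappa> / 2\<close>.\<close>
    define \<eta> where "\<eta> = min (\<kappa> / 4) (1 / 2)"
    have \<eta>: "\<eta> > 0" using \<kappa> by (simp add: \<eta>_def)
    define E where "E n = {x \<in> space (sample_space M n). ennreal \<eta> \<le> (\<integral>\<^sup>+\<theta>\<in>F. g \<theta> \<partial>post n x)}" for n
    have lim: "(\<lambda>n. measure (iid_law (P \<theta>\<^sub>0) n) (E n)) \<longlonglongrightarrow> 0"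
      unfolding E_def F_def
      by (rule posterior_concentration[OF \<theta>\<^sub>0 model prior_measure _ \<phi> tv(1,2) _ mass(1,2) _ g g_finite \<eta>])
        (fact posterior mass(3) tv(3)[unfolded measurable_cong_sets[OF dominating(2) refl]])+
    \<comment> \<open>Outside \<open>E n\<close>, an estimate at distance more than \<open>B\<close>
      would have expected loss at least \<open>\<kappa> / 2\<close>, more than that of
      \<open>\<theta>\<^sub>0\<close>, against minimality.\<close>
    have bayes_far: "x \<in> E n"
      if n: "n \<ge> 1" and x: "x \<in> space (sample_space M n)" and T: "norm (est n x - \<theta>\<^sub>0) > B"
        and min: "is_arg_min (expected_loss loss (post n x)) (\<lambda>t. t \<in> \<Theta>) (est n x)" for n x
    proof (rule ccontr)
      assume "x \<notin> E n"
      then have G: "(\<integral>\<^sup>+\<theta>\<in>F. g \<theta> \<partial>post n x) < ennreal \<eta>" using x by (simp add: E_def not_le)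
      have "post n x \<in> space (prob_algebra prior)"
        using posterior[OF n] x by (auto simp: is_posterior_def dest: measurable_space)
      then have K: "sets (post n x) = sets prior" "prob_space (post n x)"
        by (auto simp: space_prob_algebra)
      interpret K: prob_space "post n x" by (rule K)
      have spK: "space (post n x) = \<Theta>" using sets_eq_imp_space_eq[OF K(1)] space_prior by simp
      have FK: "F \<in> sets (post n x)" "N \<in> sets (post n x)" using F N K by auto
      have lossK: "(\<lambda>\<theta>. loss t \<theta>) \<in> borel_measurable (post n x)" if "t \<in> \<Theta>" for t
        unfolding measurable_cong_sets[OF K(1) refl] using that by (rule loss_meas)
      have T\<Theta>: "est n x \<in> \<Theta>" using min by (simp add: is_arg_min_def)
      have "emeasure (post n x) F = (\<integral>\<^sup>+\<theta>. indicator F \<theta> \<partial>post n x)" using FK by simp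
      also have "\<dots> \<le> (\<integral>\<^sup>+\<theta>\<in>F. g \<theta> \<partial>post n x)"
        by (intro nn_integral_mono) (auto simp: g_def indicator_def)
      also note G
      also have "ennreal \<eta> \<le> ennreal (1 / 2)" by (intro ennreal_leI) (simp add: \<eta>_def)
      finally have "ennreal (measure (post n x) F) < ennreal (1 / 2)"
        unfolding K.emeasure_eq_measure .
      then have "measure (post n x) F < 1 / 2"
        by (subst (asm) ennreal_less_iff) (rule measure_nonneg)
      moreover have "measure (post n x) N = 1 - measure (post n x) F"
        using K.prob_compl[OF FK(1)] by (simp add: spK N_def)
      ultimately have "1 / 2 \<le> measure (post n x) N" by simp
      then have "\<kappa> / 2 \<le> \<kappa> * measure (post n x) N" using \<kappa> by simp
      then have "ennreal (\<kappa> / 2) \<le> ennreal \<kappa> * emeasure (post n x) N"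
        using \<kappa> by (simp add: K.emeasure_eq_measure ennreal_mult[symmetric] ennreal_leI)
      also have "\<dots> = (\<integral>\<^sup>+\<theta>. ennreal \<kappa> * indicator N \<theta> \<partial>post n x)"
        using FK by (simp add: nn_integral_cmult_indicator)
      also have "\<dots> \<le> expected_loss loss (post n x) (est n x)"
        unfolding expected_loss_def
      proof (rule nn_integral_mono)
        fix \<theta>
        have "\<kappa> \<le> loss (est n x) \<theta>" if "\<theta> \<in> N"
          using that by (intro \<delta>1(2) T\<Theta> T) (auto simp: N_def F_def \<delta>_def)
        then show "ennreal \<kappa> * indicator N \<theta> \<le> ennreal (loss (est n x) \<theta>)"
          by (auto simp: indicator_def intro: ennreal_leI)
      qed
      also have "\<dots> \<le> expected_loss loss (post n x) \<theta>\<^sub>0"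
        using min \<theta>\<^sub>0 by (auto simp: is_arg_min_def not_less)
      also have "\<dots> \<le> (\<integral>\<^sup>+\<theta>. ennreal (\<kappa> / 4) + g \<theta> * indicator F \<theta> \<partial>post n x)"
        unfolding expected_loss_def
      proof (rule nn_integral_mono)
        fix \<theta> assume "\<theta> \<in> space (post n x)"
        then have \<theta>: "\<theta> \<in> \<Theta>" by (simp add: spK)
        show "ennreal (loss \<theta>\<^sub>0 \<theta>) \<le> ennreal (\<kappa> / 4) + g \<theta> * indicator F \<theta>"
        proof (cases "\<theta> \<in> F")
          case True
          then show ?thesis by (auto simp: g_def intro!: add_increasing add_increasing2)
        next
          case False
          then have "loss \<theta>\<^sub>0 \<theta> < \<kappa> / 4" using \<theta> by (intro \<delta>2(2)) (auto simp: F_def \<delta>_def)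
          then show ?thesis using False by (simp add: ennreal_leI)
        qed
      qed
      also have "\<dots> = ennreal (\<kappa> / 4) + (\<integral>\<^sup>+\<theta>\<in>F. g \<theta> \<partial>post n x)"
      proof -
        have "(\<lambda>\<theta>. g \<theta> * indicator F \<theta>) \<in> borel_measurable (post n x)"
          unfolding measurable_cong_sets[OF K(1) refl] using g F by simp
        then show ?thesis by (simp add: nn_integral_add K.emeasure_space_1)
      qed
      also have "\<dots> < ennreal (\<kappa> / 4) + ennreal \<eta>"
        using G by (simp add: ennreal_add_left_cancel_less)
      also have "\<dots> \<le> ennreal (\<kappa> / 2)"
        using \<kappa> \<eta> by (simp add: ennreal_plus[symmetric] \<eta>_def ennreal_leI del: ennreal_plus)
      finally show False by simp
    qed
    have "measure (iid_law (P \<theta>\<^sub>0) n) {x \<in> space (iid_law (P \<theta>\<^sub>0) n). norm (est n x - \<theta>\<^sub>0) > B}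
        \<le> measure (iid_law (P \<theta>\<^sub>0) n) (E n)" if n: "n \<ge> 1" for n
    proof -
      interpret P0: prob_space "iid_law (P \<theta>\<^sub>0) n" using P[OF \<theta>\<^sub>0] by (intro prob_space_PiM)
      have "sets (iid_law (P \<theta>\<^sub>0) n) = sets (marginal_law M P prior n)"
        using sP by (simp add: marginal_law_def)
      \<comment> \<open>The estimator minimises only almost everywhere under the marginal law;
        absolute continuity carries this over to the law under
        \<open>\<theta>\<^sub>0\<close>.\<close>
      then have "AE x in iid_law (P \<theta>\<^sub>0) n. is_arg_min (expected_loss loss (post n x)) (\<lambda>t. t \<in> \<Theta>) (est n x)"
        using marginal_dominates[OF n] bayes[OF n, unfolded is_bayes_estimator_def, THEN conjunct2]
        by (rule absolutely_continuous_AE)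
      then have "AE x in iid_law (P \<theta>\<^sub>0) n. x \<in> {x \<in> space (iid_law (P \<theta>\<^sub>0) n). norm (est n x - \<theta>\<^sub>0) > B} \<longrightarrow> x \<in> E n"
        using AE_space by eventually_elim (use bayes_far[OF n] spP in auto)
      moreover have "E n \<in> sets (iid_law (P \<theta>\<^sub>0) n)"
      proof -
        have "post n \<in> sample_space M n \<rightarrow>\<^sub>M subprob_algebra prior"
          using posterior[OF n] by (auto simp: is_posterior_def dest: measurable_prob_algebraD)
        then have "(\<lambda>x. \<integral>\<^sup>+\<theta>\<in>F. g \<theta> \<partial>post n x) \<in> borel_measurable (sample_space M n)"
          using nn_integral_measurable_subprob_algebra2[of "\<lambda>_ \<theta>. g \<theta> * indicator F \<theta>"] g F by simp
        then show ?thesis unfolding E_def sP by (intro borel_measurable_le) auto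
      qed
      ultimately show ?thesis by (intro P0.finite_measure_mono_AE)
    qed
    then have "\<forall>\<^sub>F n in sequentially. measure (iid_law (P \<theta>\<^sub>0) n) {x \<in> space (iid_law (P \<theta>\<^sub>0) n). norm (est n x - \<theta>\<^sub>0) > B}
        \<le> measure (iid_law (P \<theta>\<^sub>0) n) (E n)"
      by (rule eventually_sequentiallyI)
    then show "(\<lambda>n. measure (iid_law (P \<theta>\<^sub>0) n) {x \<in> space (iid_law (P \<theta>\<^sub>0) n). norm (est n x - \<theta>\<^sub>0) > B}) \<longlonglongrightarrow> 0"
      by (intro tendsto_sandwich[OF _ _ tendsto_const lim]) auto
  qed
qed

end
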